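(* Let $k$ be a field, let $P$ be a prime ideal of the polynomial ring $S:=k[X_1,\dots,X_d]$ generated by linear forms, and let $R:=S/P^n$ for some integer $n>0$. Let $\mathfrak q\in\operatorname{Assh}(R)$ and $u\in\mathfrak q$. Then $(0:_R u)$ is not contained in any ideal $I$ of $R$ generated by a homogeneous system of parameters.
   Context: $S$ carries the standard grading and $R$ the induced grading. $\operatorname{Assh}(R)=\{\mathfrak p\in\operatorname{Ass}(R):\dim R/\mathfrak p=\dim R\}$; $(0:_R u)=\{r\in R: ru=0\}$. A homogeneous system of parameters of $R$ is a sequence of $\dim R$ homogeneous elements of positive degree such that the quotient of $R$ by the ideal they generate has finite length. *)

theory Defs
  imports "HOL-Library.Poly_Mapping" "HOL-Library.Extended_Nat" "HOL-Algebra.Algebra"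
begin

section \<open>The standard graded polynomial ring\<close>

text \<open>
  A monomial is a finitely supported exponent vector \<open>nat \<Rightarrow>\<^sub>0 nat\<close> and a polynomial a finitely
  supported coefficient function on monomials, multiplied by convolution. The polynomial ring
  \<open>k[X\<^sub>1,\<dots>,X\<^sub>d]\<close> consists of the polynomials all of whose monomials involve only the variables
  with indices in \<open>{1..d}\<close>.
\<close>

definition mpoly_ring :: "nat \<Rightarrow> ((nat \<Rightarrow>\<^sub>0 nat) \<Rightarrow>\<^sub>0 'k::field) ring"
  where "mpoly_ring d =
    \<lparr>carrier = {f. \<forall>m \<in> Poly_Mapping.keys f. Poly_Mapping.keys m \<subseteq> {1..d}},
     monoid.mult = (*), one = 1, ring.zero = 0, ring.add = (+)\<rparr>"

definition monom_degree :: "(nat \<Rightarrow>\<^sub>0 nat) \<Rightarrow> nat"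
  where "monom_degree m = (\<Sum>i \<in> Poly_Mapping.keys m. Poly_Mapping.lookup m i)"

definition mpoly_grading :: "nat \<Rightarrow> nat \<Rightarrow> ((nat \<Rightarrow>\<^sub>0 nat) \<Rightarrow>\<^sub>0 'k::field) set"
  where "mpoly_grading d i =
    {f \<in> carrier (mpoly_ring d). \<forall>m \<in> Poly_Mapping.keys f. monom_degree m = i}"

text \<open>A linear form is an element of degree one (the zero form included).\<close>

abbreviation linear_forms :: "nat \<Rightarrow> ((nat \<Rightarrow>\<^sub>0 nat) \<Rightarrow>\<^sub>0 'k::field) set"
  where "linear_forms d \<equiv> mpoly_grading d 1"

lemma cring_mpoly_ring: "cring (mpoly_ring d :: ((nat \<Rightarrow>\<^sub>0 nat) \<Rightarrow>\<^sub>0 'k::field) ring)"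
proof (rule cringI)
  show "abelian_group (mpoly_ring d :: ((nat \<Rightarrow>\<^sub>0 nat) \<Rightarrow>\<^sub>0 'k::field) ring)"
  proof (rule abelian_groupI)
    fix x y :: "(nat \<Rightarrow>\<^sub>0 nat) \<Rightarrow>\<^sub>0 'k"
    assume "x \<in> carrier (mpoly_ring d)" "y \<in> carrier (mpoly_ring d)"
    then show "x \<oplus>\<^bsub>mpoly_ring d\<^esub> y \<in> carrier (mpoly_ring d)"
      using Poly_Mapping.keys_add[of x y] by (fastforce simp: mpoly_ring_def)
  next
    fix x :: "(nat \<Rightarrow>\<^sub>0 nat) \<Rightarrow>\<^sub>0 'k"
    assume "x \<in> carrier (mpoly_ring d)"
    then have "- x \<in> carrier (mpoly_ring d)" "- x \<oplus>\<^bsub>mpoly_ring d\<^esub> x = \<zero>\<^bsub>mpoly_ring d\<^esub>"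
      by (auto simp: mpoly_ring_def)
    then show "\<exists>y\<in>carrier (mpoly_ring d). y \<oplus>\<^bsub>mpoly_ring d\<^esub> x = \<zero>\<^bsub>mpoly_ring d\<^esub>"
      by blast
  qed (auto simp: mpoly_ring_def algebra_simps)
  show "comm_monoid (mpoly_ring d :: ((nat \<Rightarrow>\<^sub>0 nat) \<Rightarrow>\<^sub>0 'k::field) ring)"
  proof (rule comm_monoidI)
    fix x y :: "(nat \<Rightarrow>\<^sub>0 nat) \<Rightarrow>\<^sub>0 'k"
    assume xy: "x \<in> carrier (mpoly_ring d)" "y \<in> carrier (mpoly_ring d)"
    show "x \<otimes>\<^bsub>mpoly_ring d\<^esub> y \<in> carrier (mpoly_ring d)"
      unfolding mpoly_ring_def
    proof (simp, intro ballI)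
      fix m assume "m \<in> Poly_Mapping.keys (x * y)"
      then obtain a b where "a \<in> Poly_Mapping.keys x" "b \<in> Poly_Mapping.keys y" "m = a + b"
        using Poly_Mapping.keys_mult[of x y] by blast
      then show "Poly_Mapping.keys m \<subseteq> {Suc 0..d}"
        using xy Poly_Mapping.keys_add[of a b] by (fastforce simp: mpoly_ring_def)
    qed
  qed (auto simp: mpoly_ring_def algebra_simps)
qed (auto simp: mpoly_ring_def algebra_simps)

section \<open>Dimension, length and associated primes\<close>

text \<open>
  Supremum of the lengths \<open>m\<close> of strict chains \<open>C 0 \<subset> \<dots> \<subset> C m\<close> in a family of sets (\<open>\<infinity>\<close> if
  the lengths are unbounded, and \<open>0\<close> for the empty family).
\<close>

definition chain_length :: "'a set set \<Rightarrow> enat"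
  where "chain_length F =
    Sup {enat m |m. \<exists>C :: nat \<Rightarrow> 'a set. (\<forall>i\<le>m. C i \<in> F) \<and> (\<forall>i<m. C i \<subset> C (Suc i))}"

text \<open>With this definition the zero ring gets dimension \<open>0\<close>.\<close>

definition krull_dim :: "('a, 'b) ring_scheme \<Rightarrow> enat"
  where "krull_dim R = chain_length {p. primeideal p R}"

definition module_length :: "('a, 'c) ring_scheme \<Rightarrow> ('a, 'b, 'd) module_scheme \<Rightarrow> enat"
  where "module_length R M = chain_length {N. submodule N R M}"

definition quot_module :: "('a, 'b) ring_scheme \<Rightarrow> 'a set \<Rightarrow> ('a, 'a set) module"
  where "quot_module R I =
    ring.extend (R Quot I) (module.fields (\<lambda>r x. (I +>\<^bsub>R\<^esub> r) \<otimes>\<^bsub>R Quot I\<^esub> x))"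

lemma (in cring) module_quot_module:
  assumes "ideal I R"
  shows "module R (quot_module R I)"
proof -
  interpret Q: cring "R Quot I"
    using ideal.quotient_is_cring[OF assms is_cring] .
  interpret h: ring_hom_ring R "R Quot I" "(+>) I"
    using ideal.rcos_ring_hom_ring[OF assms] .
  have sel: "carrier (quot_module R I) = carrier (R Quot I)"
    "ring.add (quot_module R I) = ring.add (R Quot I)"
    "ring.zero (quot_module R I) = ring.zero (R Quot I)"
    "smult (quot_module R I) = (\<lambda>r x. (I +> r) \<otimes>\<^bsub>R Quot I\<^esub> x)"
    by (simp_all add: quot_module_def ring.defs module.defs)
  show ?thesis
  proof (rule moduleI)
    show "cring R" by (rule is_cring)
    show "abelian_group (quot_module R I)"
    proof (rule abelian_groupI)
      fix x assume "x \<in> carrier (quot_module R I)"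
      then show "\<exists>y\<in>carrier (quot_module R I). y \<oplus>\<^bsub>quot_module R I\<^esub> x = \<zero>\<^bsub>quot_module R I\<^esub>"
        using Q.l_neg Q.a_inv_closed unfolding sel by blast
    qed (simp_all add: sel Q.a_ac)
  qed (auto simp: sel Q.l_distr Q.r_distr Q.m_assoc)
qed

definition annihilator :: "('a, 'b) ring_scheme \<Rightarrow> 'a \<Rightarrow> 'a set"
  where "annihilator R u = {r \<in> carrier R. r \<otimes>\<^bsub>R\<^esub> u = \<zero>\<^bsub>R\<^esub>}"

definition Ass :: "('a, 'b) ring_scheme \<Rightarrow> 'a set set"
  where "Ass R = {p. primeideal p R \<and> (\<exists>x \<in> carrier R. p = annihilator R x)}"

definition Assh :: "('a, 'b) ring_scheme \<Rightarrow> 'a set set"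
  where "Assh R = {p \<in> Ass R. krull_dim (R Quot p) = krull_dim R}"

section \<open>Homogeneous systems of parameters\<close>

text \<open>A grading is given by its family of homogeneous components.\<close>

definition quot_grading :: "('a, 'b) ring_scheme \<Rightarrow> (nat \<Rightarrow> 'a set) \<Rightarrow> 'a set \<Rightarrow> nat \<Rightarrow> 'a set set"
  where "quot_grading R G I i = (\<lambda>f. I +>\<^bsub>R\<^esub> f) ` G i"

definition hsop :: "('a, 'b) ring_scheme \<Rightarrow> (nat \<Rightarrow> 'a set) \<Rightarrow> 'a list \<Rightarrow> bool"
  where "hsop R G xs \<longleftrightarrow>
    enat (length xs) = krull_dim R \<and>
    (\<forall>x \<in> set xs. \<exists>i>0. x \<in> G i) \<and>
    module_length R (quot_module R (Idl\<^bsub>R\<^esub> (set xs))) < \<infinity>"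

end

(*
  For dimension reasons q = P/P^n. If P = 0 then u = 0, and (0 : u) = R is not contained in an ideal
  generated in positive degrees. Let P be nonzero. Since u lies in P/P^n, it is annihilated by P^(n-1).
  Lift a homogeneous system of parameters to F_1, ..., F_r in S. If (0 : u) lies in the ideal it
  generates, then P^(n-1) is contained in (F) + P * P^(n-1), hence in (F) by the graded Nakayama lemma.
  So (F) = (F) + P^n has finite colength in S, and counting monomials forces r >= d. But r = dim R < d,
  because S is a domain with dim S <= d and P is nonzero.
*)
theory Submission
  imports Defs
begin

text \<open>Both numerical inputs, \<open>r >= d\<close> and \<open>dim S <= d\<close>, rest on one
  pigeonhole argument: there are \<open>(s + 1) ^ d\<close> monomials in \<open>d\<close> variables
  with exponents at most \<open>s\<close>, and for suitable \<open>s\<close> this exceeds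
  \<open>c * (a * s + 1) ^ r\<close> if \<open>r < d\<close>. The former counts products of the
  \<open>F_i\<close>; the latter finds an algebraic relation among any \<open>d + 1\<close>
  polynomials, whereas a chain of primes of length \<open>d + 1\<close> would supply elements
  satisfying none. The dimension reasons behind \<open>q = P/P^n\<close> are that \<open>P\<close>
  is the least prime over \<open>P^n\<close>: any other prime \<open>q\<close> of \<open>R\<close>
  lies strictly above \<open>P/P^n\<close>, which prolongs every chain of primes above
  \<open>q\<close> by one. A contradiction with \<open>dim R/q = dim R\<close> then requires
  \<open>dim R\<close> to be finite, and this is contained in the existence of a system of
  parameters. Elements of \<open>R\<close> are cosets, without components of their own, so ideals of
  \<open>R\<close> are pulled back to \<open>S\<close> before the grading is used.\<close>

type_synonym 'k mpoly = "(nat \<Rightarrow>\<^sub>0 nat) \<Rightarrow>\<^sub>0 'k"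

section \<open>Arithmetic and ideals of the polynomial ring, in terms of the operations of the
  type\<close>

lemma mpoly_ring_simps [simp]:
  "monoid.mult (mpoly_ring d) = (*)" "one (mpoly_ring d) = 1"
  "ring.zero (mpoly_ring d) = 0" "ring.add (mpoly_ring d) = (+)"
  by (simp_all add: mpoly_ring_def)

lemma mem_carrier_mpoly_ring:
  "f \<in> carrier (mpoly_ring d) \<longleftrightarrow> (\<forall>m \<in> Poly_Mapping.keys f. Poly_Mapping.keys m \<subseteq> {1..d})"
  by (simp add: mpoly_ring_def)

lemma mpoly_carrier_uminus:
  "f \<in> carrier (mpoly_ring d) \<Longrightarrow> - f \<in> carrier (mpoly_ring d)"
  by (simp add: mem_carrier_mpoly_ring)

lemma mpoly_carrier_closed:
  fixes f g :: "'k::field mpoly"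
  assumes "f \<in> carrier (mpoly_ring d)" "g \<in> carrier (mpoly_ring d)"
  shows "f + g \<in> carrier (mpoly_ring d)" "f * g \<in> carrier (mpoly_ring d)"
    "f - g \<in> carrier (mpoly_ring d)"
proof -
  interpret cring "mpoly_ring d :: 'k mpoly ring" by (rule cring_mpoly_ring)
  show "f + g \<in> carrier (mpoly_ring d)" "f * g \<in> carrier (mpoly_ring d)"
    using a_closed[OF assms] m_closed[OF assms] by simp_all
  show "f - g \<in> carrier (mpoly_ring d)"
    using a_closed[OF assms(1) mpoly_carrier_uminus[OF assms(2)]] by simp
qed

lemma mpoly_carrier_0_1 [simp]:
  "0 \<in> carrier (mpoly_ring d)" "1 \<in> carrier (mpoly_ring d)"
  by (auto simp: mem_carrier_mpoly_ring)

lemma mpoly_carrier_single: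
  "Poly_Mapping.keys m \<subseteq> {1..d} \<Longrightarrow> Poly_Mapping.single m c \<in> carrier (mpoly_ring d)"
  by (auto simp: mem_carrier_mpoly_ring)

lemma mpoly_carrier_sum:
  "(\<And>i. i \<in> A \<Longrightarrow> f i \<in> carrier (mpoly_ring d)) \<Longrightarrow> sum f A \<in> carrier (mpoly_ring d)"
  by (induction A rule: infinite_finite_induct) (auto intro: mpoly_carrier_closed)

lemma mpoly_carrier_prod:
  "(\<And>i. i \<in> A \<Longrightarrow> f i \<in> carrier (mpoly_ring d)) \<Longrightarrow> prod f A \<in> carrier (mpoly_ring d)"
  by (induction A rule: infinite_finite_induct) (auto intro: mpoly_carrier_closed)

lemma mpoly_carrier_power:
  "f \<in> carrier (mpoly_ring d) \<Longrightarrow> f ^ n \<in> carrier (mpoly_ring d)"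
  by (induction n) (auto intro: mpoly_carrier_closed)

lemma a_inv_mpoly_ring:
  fixes f :: "'k::field mpoly"
  assumes "f \<in> carrier (mpoly_ring d)"
  shows "\<ominus>\<^bsub>mpoly_ring d\<^esub> f = - f"
proof -
  interpret cring "mpoly_ring d :: 'k mpoly ring" by (rule cring_mpoly_ring)
  show ?thesis using assms mpoly_carrier_uminus[OF assms] by (intro minus_equality) auto
qed

text \<open>Negation is multiplication by the constant \<open>- 1\<close>, so additive inverses come
  from absorption; one-sided absorption suffices by commutativity.\<close>

lemma ideal_mpolyI:
  fixes I :: "'k::field mpoly set"
  assumes sub: "I \<subseteq> carrier (mpoly_ring d)" and "0 \<in> I"
    and "\<And>f g. f \<in> I \<Longrightarrow> g \<in> I \<Longrightarrow> f + g \<in> I"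
    and mult: "\<And>f g. f \<in> carrier (mpoly_ring d) \<Longrightarrow> g \<in> I \<Longrightarrow> f * g \<in> I"
  shows "ideal I (mpoly_ring d)"
proof -
  interpret cring "mpoly_ring d :: 'k mpoly ring" by (rule cring_mpoly_ring)
  show ?thesis
  proof (rule idealI)
    show "subgroup I (add_monoid (mpoly_ring d))"
    proof (rule add.subgroupI)
      fix f assume f: "f \<in> I"
      have "- 1 * f \<in> I"
        by (intro mult f mpoly_carrier_uminus mpoly_carrier_0_1)
      then show "\<ominus>\<^bsub>mpoly_ring d\<^esub> f \<in> I" using sub f by (simp add: a_inv_mpoly_ring subsetD)
    qed (use assms in auto)
  next
    fix f g :: "'k mpoly" assume "f \<in> I" "g \<in> carrier (mpoly_ring d)"
    then have "g * f \<in> I" by (intro mult)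
    then show "g \<otimes>\<^bsub>mpoly_ring d\<^esub> f \<in> I" "f \<otimes>\<^bsub>mpoly_ring d\<^esub> g \<in> I"
      by (simp_all add: mult.commute)
  qed (rule ring_axioms)
qed

context
  fixes d :: nat and I :: "'k::field mpoly set"
  assumes I: "ideal I (mpoly_ring d)"
begin

interpretation ideal I "mpoly_ring d" by (rule I)

lemma ideal_mpoly_carrier: "f \<in> I \<Longrightarrow> f \<in> carrier (mpoly_ring d)"
  by (rule Icarr)

lemma ideal_mpoly_0: "0 \<in> I"
  using additive_subgroup.zero_closed[OF is_additive_subgroup] by simp

lemma ideal_mpoly_add: "f \<in> I \<Longrightarrow> g \<in> I \<Longrightarrow> f + g \<in> I"
  using additive_subgroup.a_closed[OF is_additive_subgroup, of f g] by simp

lemma ideal_mpoly_mult: "f \<in> carrier (mpoly_ring d) \<Longrightarrow> g \<in> I \<Longrightarrow> f * g \<in> I"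
  using I_l_closed[of g f] by simp

lemma ideal_mpoly_minus: "f \<in> I \<Longrightarrow> - f \<in> I"
  using ideal_mpoly_mult[of "- 1" f] mpoly_carrier_uminus[of 1 d] by simp

lemma ideal_mpoly_diff: "f \<in> I \<Longrightarrow> g \<in> I \<Longrightarrow> f - g \<in> I"
  using ideal_mpoly_add[of f "- g"] ideal_mpoly_minus by simp

lemma ideal_mpoly_sum: "(\<And>i. i \<in> A \<Longrightarrow> f i \<in> I) \<Longrightarrow> sum f A \<in> I"
  by (induction A rule: infinite_finite_induct) (auto intro: ideal_mpoly_0 ideal_mpoly_add)

end

section \<open>Homogeneous components\<close>

lemma monom_degree_superset:
  assumes "finite A" "Poly_Mapping.keys m \<subseteq> A"
  shows "monom_degree m = (\<Sum>i\<in>A. Poly_Mapping.lookup m i)"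
  unfolding monom_degree_def using assms
  by (intro sum.mono_neutral_left) (auto simp: in_keys_iff)

lemma monom_degree_0 [simp]: "monom_degree 0 = 0"
  by (simp add: monom_degree_def)

lemma monom_degree_single [simp]: "monom_degree (Poly_Mapping.single i c) = c"
  by (subst monom_degree_superset[of "{i}"]) auto

lemma monom_degree_add: "monom_degree (a + b) = monom_degree a + monom_degree b"
proof -
  let ?A = "Poly_Mapping.keys a \<union> Poly_Mapping.keys b"
  have "Poly_Mapping.keys (a + b) \<subseteq> ?A" by (rule Poly_Mapping.keys_add)
  then show ?thesis
    by (simp add: monom_degree_superset[of ?A] lookup_add sum.distrib)
qed

lemma lookup_le_monom_degree: "Poly_Mapping.lookup m i \<le> monom_degree m"
  by (cases "i \<in> Poly_Mapping.keys m")
    (auto simp: monom_degree_def in_keys_iff intro: member_le_sum)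

definition homog :: "nat \<Rightarrow> 'k::field mpoly \<Rightarrow> bool"
  where "homog i f \<longleftrightarrow> (\<forall>m \<in> Poly_Mapping.keys f. monom_degree m = i)"

lemma mem_mpoly_grading: "f \<in> mpoly_grading d i \<longleftrightarrow> f \<in> carrier (mpoly_ring d) \<and> homog i f"
  by (simp add: mpoly_grading_def homog_def)

lemma homog_mult: "homog i f \<Longrightarrow> homog j g \<Longrightarrow> homog (i + j) (f * g)"
  unfolding homog_def using Poly_Mapping.keys_mult[of f g] by (fastforce simp: monom_degree_add)

definition hcomp :: "nat \<Rightarrow> 'k::field mpoly \<Rightarrow> 'k mpoly"
  where "hcomp i = Poly_Mapping.mapp (\<lambda>m c. if monom_degree m = i then c else 0)"

lemma lookup_hcomp:
  "Poly_Mapping.lookup (hcomp i f) m = (if monom_degree m = i then Poly_Mapping.lookup f m else 0)"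
  by (auto simp: hcomp_def lookup_mapp when_def in_keys_iff)

lemma keys_hcomp: "Poly_Mapping.keys (hcomp i f) = {m \<in> Poly_Mapping.keys f. monom_degree m = i}"
  by (auto simp: in_keys_iff lookup_hcomp split: if_splits)

lemma homog_hcomp: "homog i (hcomp i f)"
  by (simp add: homog_def keys_hcomp)

lemma hcomp_carrier: "f \<in> carrier (mpoly_ring d) \<Longrightarrow> hcomp i f \<in> carrier (mpoly_ring d)"
  by (simp add: mem_carrier_mpoly_ring keys_hcomp)

lemma hcomp_0 [simp]: "hcomp i 0 = 0"
  by (rule poly_mapping_eqI) (simp add: lookup_hcomp)

lemma hcomp_add: "hcomp i (f + g) = hcomp i f + hcomp i g"
  by (rule poly_mapping_eqI) (simp add: lookup_hcomp lookup_add)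

lemma hcomp_sum: "hcomp i (sum f A) = (\<Sum>a\<in>A. hcomp i (f a))"
  by (rule poly_mapping_eqI) (simp add: lookup_hcomp lookup_sum)

lemma hcomp_homog: "homog i f \<Longrightarrow> hcomp j f = (if i = j then f else 0)"
  by (rule poly_mapping_eqI) (auto simp: lookup_hcomp homog_def in_keys_iff)

lemma sum_hcomp:
  assumes "\<And>m. m \<in> Poly_Mapping.keys f \<Longrightarrow> monom_degree m \<le> n"
  shows "(\<Sum>i\<le>n. hcomp i f) = f"
proof (rule poly_mapping_eqI)
  fix m
  show "Poly_Mapping.lookup (\<Sum>i\<le>n. hcomp i f) m = Poly_Mapping.lookup f m"
    using assms[of m] by (cases "m \<in> Poly_Mapping.keys f")
      (auto simp: lookup_sum lookup_hcomp in_keys_iff)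
qed

lemma ex_degree_bound:
  fixes f :: "'k::field mpoly"
  shows "\<exists>n. \<forall>m \<in> Poly_Mapping.keys f. monom_degree m \<le> n"
  by (meson finite_nat_set_iff_bounded_le finite_imageI finite_keys image_eqI)

lemma hcomp_mult: "hcomp n (f * g) = (\<Sum>i\<le>n. hcomp i f * hcomp (n - i) g)"
proof -
  obtain n1 where n1: "\<forall>m \<in> Poly_Mapping.keys f. monom_degree m \<le> n1"
    using ex_degree_bound by blast
  obtain n2 where n2: "\<forall>m \<in> Poly_Mapping.keys g. monom_degree m \<le> n2"
    using ex_degree_bound by blast
  \<comment> \<open>Large enough for \<open>f\<close> and \<open>g\<close> to be the sums of their
    components up to \<open>N\<close>, and for every pair \<open>(i, n - i)\<close> with
    \<open>i <= n\<close> to occur among the indices.\<close>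
  define N where "N = n1 + n2 + n"
  have f: "f = (\<Sum>i\<le>N. hcomp i f)" and g: "g = (\<Sum>j\<le>N. hcomp j g)"
    using n1 n2 by (auto simp: N_def intro!: sum_hcomp[symmetric] intro: order_trans)
  have "f * g = (\<Sum>i\<le>N. \<Sum>j\<le>N. hcomp i f * hcomp j g)"
    by (subst f, subst g) (simp add: sum_product)
  then have "hcomp n (f * g) = (\<Sum>i\<le>N. \<Sum>j\<le>N. hcomp n (hcomp i f * hcomp j g))"
    by (simp add: hcomp_sum)
  also have "\<dots> = (\<Sum>i\<le>N. \<Sum>j\<le>N. if i + j = n then hcomp i f * hcomp j g else 0)"
    by (intro sum.cong refl hcomp_homog homog_mult homog_hcomp)
  also have "\<dots> = (\<Sum>i\<le>N. if i \<le> n then hcomp i f * hcomp (n - i) g else 0)"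
  proof (intro sum.cong refl)
    fix i
    have "(\<Sum>j\<le>N. if i + j = n then hcomp i f * hcomp j g else 0)
      = (\<Sum>j\<le>N. if j = n - i then (if i \<le> n then hcomp i f * hcomp j g else 0) else 0)"
      by (intro sum.cong refl) auto
    also have "\<dots> = (if i \<le> n then hcomp i f * hcomp (n - i) g else 0)"
      by (subst sum.delta) (auto simp: N_def)
    finally show "(\<Sum>j\<le>N. if i + j = n then hcomp i f * hcomp j g else 0)
      = (if i \<le> n then hcomp i f * hcomp (n - i) g else 0)" .
  qed
  also have "\<dots> = (\<Sum>i\<in>{..N} \<inter> {..n}. hcomp i f * hcomp (n - i) g)"
    by (subst sum.inter_restrict) auto
  also have "{..N} \<inter> {..n} = {..n}" by (auto simp: N_def)
  finally show ?thesis .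
qed

lemma hcomp_mult_homog:
  assumes "homog e g"
  shows "hcomp n (f * g) = (if e \<le> n then hcomp (n - e) f * g else 0)"
proof -
  have "hcomp n (f * g) = (\<Sum>i\<le>n. if i = n - e then (if e \<le> n then hcomp i f * g else 0) else 0)"
    unfolding hcomp_mult by (intro sum.cong refl) (auto simp: hcomp_homog[OF assms])
  also have "\<dots> = (if e \<le> n then hcomp (n - e) f * g else 0)"
    by (subst sum.delta) auto
  finally show ?thesis .
qed

section \<open>Homogeneous ideals\<close>

definition homog_ideal :: "nat \<Rightarrow> 'k::field mpoly set \<Rightarrow> bool"
  where "homog_ideal d I \<longleftrightarrow> ideal I (mpoly_ring d) \<and> (\<forall>f\<in>I. \<forall>i. hcomp i f \<in> I)"

lemma homog_idealD: "homog_ideal d I \<Longrightarrow> ideal I (mpoly_ring d)"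
  "homog_ideal d I \<Longrightarrow> f \<in> I \<Longrightarrow> hcomp i f \<in> I"
  by (simp_all add: homog_ideal_def)

lemma homog_ideal_mem:
  assumes "ideal I (mpoly_ring d)" "\<And>i. hcomp i f \<in> I"
  shows "f \<in> I"
proof -
  obtain n where "\<forall>m \<in> Poly_Mapping.keys f. monom_degree m \<le> n"
    using ex_degree_bound by blast
  then have "f = (\<Sum>i\<le>n. hcomp i f)" by (simp add: sum_hcomp)
  with assms show ?thesis by (metis ideal_mpoly_sum)
qed

text \<open>The polynomials all of whose components lie in the generated ideal form an ideal
  themselves. It contains the homogeneous generators, so minimality applies.\<close>

lemma homog_ideal_genideal:
  assumes "\<And>f. f \<in> H \<Longrightarrow> \<exists>i. f \<in> mpoly_grading d i"
  shows "homog_ideal d (Idl\<^bsub>mpoly_ring d\<^esub> H)"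
proof -
  interpret cring "mpoly_ring d :: 'a mpoly ring" by (rule cring_mpoly_ring)
  let ?I = "Idl\<^bsub>mpoly_ring d\<^esub> H"
  have H: "H \<subseteq> carrier (mpoly_ring d)"
    using assms by (auto simp: mem_mpoly_grading)
  then have id: "ideal ?I (mpoly_ring d)" by (rule genideal_ideal)
  let ?J = "{f \<in> carrier (mpoly_ring d). \<forall>i. hcomp i f \<in> ?I}"
  have "ideal ?J (mpoly_ring d)"
  proof (rule ideal_mpolyI)
    fix f g :: "'a mpoly" assume "f \<in> carrier (mpoly_ring d)" "g \<in> ?J"
    then show "f * g \<in> ?J"
      by (auto simp: hcomp_mult intro!: mpoly_carrier_closed ideal_mpoly_sum[OF id]
          ideal_mpoly_mult[OF id] hcomp_carrier)
  qed (auto simp: hcomp_add ideal_mpoly_0[OF id] intro: mpoly_carrier_closed ideal_mpoly_add[OF id])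
  moreover have "H \<subseteq> ?J"
  proof
    fix f assume f: "f \<in> H"
    then obtain i where i: "homog i f" using assms by (auto simp: mem_mpoly_grading)
    have "f \<in> ?I" using genideal_self[OF H] f by auto
    then show "f \<in> ?J"
      using f H by (auto simp: hcomp_homog[OF i] ideal_mpoly_0[OF id])
  qed
  ultimately have "?I \<subseteq> ?J" by (rule genideal_minimal)
  with id show ?thesis by (auto simp: homog_ideal_def)
qed

lemma homog_ideal_carrier: "homog_ideal d (carrier (mpoly_ring d))"
proof -
  interpret cring "mpoly_ring d :: 'a mpoly ring" by (rule cring_mpoly_ring)
  show ?thesis by (simp add: homog_ideal_def oneideal hcomp_carrier)
qed

lemma homog_ideal_prod:
  fixes I :: "'k::field mpoly set"
  assumes I: "homog_ideal d I" and J: "homog_ideal d J"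
  shows "homog_ideal d (I \<cdot>\<^bsub>mpoly_ring d\<^esub> J)"
proof -
  interpret cring "mpoly_ring d :: 'k mpoly ring" by (rule cring_mpoly_ring)
  have id: "ideal (I \<cdot>\<^bsub>mpoly_ring d\<^esub> J) (mpoly_ring d)"
    by (intro ideal_prod_is_ideal homog_idealD(1)[OF I] homog_idealD(1)[OF J])
  moreover have "\<forall>n. hcomp n f \<in> I \<cdot>\<^bsub>mpoly_ring d\<^esub> J" if "f \<in> I \<cdot>\<^bsub>mpoly_ring d\<^esub> J" for f
    using that
  proof induction
    case (prod i j)
    have "hcomp a i * hcomp b j \<in> I \<cdot>\<^bsub>mpoly_ring d\<^esub> J" for a b
      using ideal_prod.prod[of "hcomp a i" I "hcomp b j" J "mpoly_ring d"] prod
      by (simp add: homog_idealD(2)[OF I] homog_idealD(2)[OF J])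
    then show ?case by (auto simp: hcomp_mult intro!: ideal_mpoly_sum[OF id])
  qed (simp add: hcomp_add ideal_mpoly_add[OF id])
  ultimately show ?thesis by (auto simp: homog_ideal_def)
qed

lemma ideals_set_pow_Suc:
  "I [^]\<^bsub>ideals_set S\<^esub> Suc n = (I [^]\<^bsub>ideals_set S\<^esub> n) \<cdot>\<^bsub>S\<^esub> I"
  "I [^]\<^bsub>ideals_set S\<^esub> (0::nat) = carrier S"
  by (simp_all add: nat_pow_def ideals_set_def)

lemma power_mem_ideals_set_pow:
  assumes "f \<in> P" "f \<in> carrier (mpoly_ring d)"
  shows "f ^ n \<in> P [^]\<^bsub>ideals_set (mpoly_ring d)\<^esub> n"
proof (induction n)
  case (Suc n)
  then show ?case
    using ideal_prod.prod[of "f ^ n" "P [^]\<^bsub>ideals_set (mpoly_ring d)\<^esub> n" f P "mpoly_ring d"] assms(1)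
    unfolding ideals_set_pow_Suc by (simp add: mult.commute)
qed (simp only: ideals_set_pow_Suc power_0 mpoly_carrier_0_1)

lemma homog_ideal_pow:
  "homog_ideal d I \<Longrightarrow> homog_ideal d (I [^]\<^bsub>ideals_set (mpoly_ring d)\<^esub> (n::nat))"
  by (induction n) (simp_all only: ideals_set_pow_Suc homog_ideal_carrier homog_ideal_prod)

lemma homog_ideal_set_add:
  fixes I :: "'k::field mpoly set"
  assumes I: "homog_ideal d I" and J: "homog_ideal d J"
  shows "homog_ideal d (I <+>\<^bsub>mpoly_ring d\<^esub> J)"
proof -
  interpret cring "mpoly_ring d :: 'k mpoly ring" by (rule cring_mpoly_ring)
  have "ideal (I <+>\<^bsub>mpoly_ring d\<^esub> J) (mpoly_ring d)"
    by (intro add_ideals homog_idealD(1)[OF I] homog_idealD(1)[OF J])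
  moreover have "hcomp n f \<in> I <+>\<^bsub>mpoly_ring d\<^esub> J" if "f \<in> I <+>\<^bsub>mpoly_ring d\<^esub> J" for f n
    using that homog_idealD(2)[OF I] homog_idealD(2)[OF J]
    by (fastforce simp: set_add_def' hcomp_add)
  ultimately show ?thesis by (auto simp: homog_ideal_def)
qed

section \<open>The irrelevant ideal and Nakayama's lemma\<close>

text \<open>The homogeneous maximal ideal generated by the variables, described by the vanishing of
  the constant term.\<close>

definition irrelevant_ideal :: "nat \<Rightarrow> 'k::field mpoly set"
  where "irrelevant_ideal d = {f \<in> carrier (mpoly_ring d). hcomp 0 f = 0}"

lemma ideal_irrelevant_ideal: "ideal (irrelevant_ideal d) (mpoly_ring d)"
  by (rule ideal_mpolyI)
    (auto simp: irrelevant_ideal_def hcomp_add hcomp_mult intro: mpoly_carrier_closed)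

lemma one_notin_irrelevant_ideal: "1 \<notin> irrelevant_ideal d"
proof -
  have "homog 0 (1 :: 'a mpoly)" by (auto simp: homog_def)
  then show ?thesis by (simp add: irrelevant_ideal_def hcomp_homog)
qed

lemma mpoly_grading_subset_irrelevant_ideal:
  "i > 0 \<Longrightarrow> mpoly_grading d i \<subseteq> irrelevant_ideal d"
  by (auto simp: irrelevant_ideal_def mem_mpoly_grading hcomp_homog)

text \<open>Induction on the degree takes the place of finite generation. In degree
  \<open>n\<close>, a product of \<open>i\<close> in \<open>M\<close> and \<open>j\<close> in
  \<open>Q\<close> involves only components of \<open>i\<close> of degree below \<open>n\<close>,
  because the constant term of \<open>j\<close> vanishes; those components lie in \<open>K\<close>
  by induction.\<close>

lemma graded_Nakayama:
  assumes M: "homog_ideal d M" and K: "homog_ideal d K"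
    and Q: "homog_ideal d Q" "Q \<subseteq> irrelevant_ideal d"
    and sub: "M \<subseteq> K <+>\<^bsub>mpoly_ring d\<^esub> (M \<cdot>\<^bsub>mpoly_ring d\<^esub> Q)"
  shows "M \<subseteq> K"
proof -
  note idK = homog_idealD(1)[OF K]
  have "\<forall>f\<in>M. hcomp n f \<in> K" for n
  proof (induction n rule: less_induct)
    case (less n)
    have z: "hcomp n z \<in> K" if "z \<in> M \<cdot>\<^bsub>mpoly_ring d\<^esub> Q" for z
      using that
    proof induction
      case (prod i j)
      have "hcomp a i * hcomp (n - a) j \<in> K" if "a \<le> n" for a
      proof (cases "a = n")
        case True
        then show ?thesis
          using prod Q(2) ideal_mpoly_0[OF idK] by (auto simp: irrelevant_ideal_def)
      next
        case False
        then have "hcomp a i \<in> K" using less prod that by auto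
        moreover have "j \<in> carrier (mpoly_ring d)"
          using prod Q(2) by (auto simp: irrelevant_ideal_def)
        ultimately show ?thesis
          using ideal_mpoly_mult[OF idK, of "hcomp (n - a) j" "hcomp a i"] 
          by (simp add: hcomp_carrier mult.commute)
      qed
      then show ?case by (auto simp: hcomp_mult intro!: ideal_mpoly_sum[OF idK])
    qed (simp add: hcomp_add ideal_mpoly_add[OF idK])
    show ?case
    proof
      fix f assume "f \<in> M"
      with sub obtain a b where "a \<in> K" "b \<in> M \<cdot>\<^bsub>mpoly_ring d\<^esub> Q" "f = a + b"
        by (auto simp: set_add_def')
      then show "hcomp n f \<in> K"
        using z homog_idealD(2)[OF K] by (simp add: hcomp_add ideal_mpoly_add[OF idK])
    qed
  qed
  then show ?thesis using homog_ideal_mem[OF idK] by blast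
qed

text \<open>For \<open>F i\<close> in the ring this is the ideal generated by
  \<open>F 0, ..., F (r - 1)\<close>. It is given by explicit combinations because the counting
  argument works on the coefficients.\<close>

definition lin_span :: "nat \<Rightarrow> nat \<Rightarrow> (nat \<Rightarrow> 'k::field mpoly) \<Rightarrow> 'k mpoly set"
  where "lin_span d r F = {\<Sum>i<r. a i * F i | a. \<forall>i. a i \<in> carrier (mpoly_ring d)}"

lemma homog_ideal_lin_span:
  assumes F: "\<And>i. i < r \<Longrightarrow> F i \<in> mpoly_grading d (e i)"
  shows "homog_ideal d (lin_span d r F)"
  unfolding homog_ideal_def
proof (intro conjI ballI allI)
  show "ideal (lin_span d r F) (mpoly_ring d)"
  proof (rule ideal_mpolyI)
    show "lin_span d r F \<subseteq> carrier (mpoly_ring d)"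
      using F by (auto simp: lin_span_def mem_mpoly_grading
          intro!: mpoly_carrier_sum mpoly_carrier_closed(2))
    show "0 \<in> lin_span d r F"
      by (auto simp: lin_span_def intro!: exI[of _ "\<lambda>_. 0"])
  next
    fix f g assume "f \<in> lin_span d r F" "g \<in> lin_span d r F"
    then obtain a b where "\<forall>i. a i \<in> carrier (mpoly_ring d)" "f = (\<Sum>i<r. a i * F i)"
      "\<forall>i. b i \<in> carrier (mpoly_ring d)" "g = (\<Sum>i<r. b i * F i)"
      by (auto simp: lin_span_def)
    then show "f + g \<in> lin_span d r F"
      by (auto simp: lin_span_def sum.distrib algebra_simps
          intro!: exI[of _ "\<lambda>i. a i + b i"] mpoly_carrier_closed(1))
  next
    fix f g :: "'a mpoly" assume f: "f \<in> carrier (mpoly_ring d)" and "g \<in> lin_span d r F"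
    then obtain b where "\<forall>i. b i \<in> carrier (mpoly_ring d)" "g = (\<Sum>i<r. b i * F i)"
      by (auto simp: lin_span_def)
    with f show "f * g \<in> lin_span d r F"
      by (auto simp: lin_span_def sum_distrib_left algebra_simps
          intro!: exI[of _ "\<lambda>i. f * b i"] mpoly_carrier_closed(2))
  qed
next
  fix f n assume "f \<in> lin_span d r F"
  then obtain a where a: "\<forall>i. a i \<in> carrier (mpoly_ring d)" "f = (\<Sum>i<r. a i * F i)"
    by (auto simp: lin_span_def)
  \<comment> \<open>Truncated subtraction would turn \<open>n - e i\<close> into 0 for
    \<open>n < e i\<close>, where the component is zero; hence the case distinction.\<close>
  have "hcomp n f = (\<Sum>i<r. (if e i \<le> n then hcomp (n - e i) (a i) else 0) * F i)"
    unfolding a(2) hcomp_sum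
  proof (intro sum.cong refl)
    fix i assume "i \<in> {..<r}"
    then have "homog (e i) (F i)" using F by (auto simp: mem_mpoly_grading)
    then show "hcomp n (a i * F i) = (if e i \<le> n then hcomp (n - e i) (a i) else 0) * F i"
      by (simp add: hcomp_mult_homog)
  qed
  with a(1) show "hcomp n f \<in> lin_span d r F"
    by (auto simp: lin_span_def hcomp_carrier
        intro!: exI[of _ "\<lambda>i. if e i \<le> n then hcomp (n - e i) (a i) else 0"])
qed

lemma lin_span_mem: "i < r \<Longrightarrow> F i \<in> lin_span d r F"
proof -
  assume i: "i < r"
  have "(\<Sum>j<r. (if j = i then 1 else 0) * F j) = (\<Sum>j<r. if j = i then F j else 0)"
    by (intro sum.cong) auto
  also have "\<dots> = F i" using i by simp
  finally have "F i = (\<Sum>j<r. (if j = i then 1 else 0) * F j)" by simp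
  then show ?thesis by (auto simp: lin_span_def intro!: exI[of _ "\<lambda>j. if j = i then 1 else 0"])
qed

lemma lin_span_subset_ideal:
  assumes "ideal I (mpoly_ring d)" "\<And>i. i < r \<Longrightarrow> F i \<in> I"
  shows "lin_span d r F \<subseteq> I"
  using assms(2) by (auto simp: lin_span_def intro!: ideal_mpoly_sum[OF assms(1)] ideal_mpoly_mult[OF assms(1)])

section \<open>Counting monomials\<close>

text \<open>Independence is a property of sets, while the counting below concerns families. An
  injective family has a dependent image by the exchange bound; in a family with a repetition, the
  difference of two equal members is already a relation.\<close>

lemma (in vector_space) ex_linear_relation:
  assumes I: "finite I" and T: "finite T" and v: "\<And>i. i \<in> I \<Longrightarrow> v i \<in> span T"
    and card: "card T < card I"
  shows "\<exists>c. (\<exists>i\<in>I. c i \<noteq> 0) \<and> (\<Sum>i\<in>I. scale (c i) (v i)) = 0"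
proof (cases "inj_on v I")
  case True
  have "dependent (v ` I)"
    using independent_span_bound[OF T, of "v ` I"] v card card_image[OF True] by force
  then obtain u where u: "\<exists>x\<in>v ` I. u x \<noteq> 0" "(\<Sum>x\<in>v ` I. scale (u x) x) = 0"
    using I by (auto simp: dependent_finite)
  with True show ?thesis
    by (intro exI[of _ "u \<circ> v"]) (auto simp: sum.reindex)
next
  case False
  then obtain i j where ij: "i \<in> I" "j \<in> I" "i \<noteq> j" "v i = v j" by (auto simp: inj_on_def)
  define c :: "'c \<Rightarrow> 'a" where "c k = (if k = i then 1 else if k = j then - 1 else 0)" for k
  have "(\<Sum>k\<in>I. scale (c k) (v k)) = (\<Sum>k\<in>{i, j}. scale (c k) (v k))"
    using I ij by (intro sum.mono_neutral_right) (auto simp: c_def)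
  also have "\<dots> = 0" using ij by (simp add: c_def)
  finally show ?thesis using ij by (intro exI[of _ c]) (auto simp: c_def)
qed

text \<open>Since \<open>a * s + 1 <= (a + 1) * (s + 1)\<close>, the left side is at most
  \<open>c * (a + 1) ^ r * (s + 1) ^ r\<close>. Taking \<open>s\<close> to be the constant
  \<open>c * (a + 1) ^ r\<close> makes this \<open>s * (s + 1) ^ r\<close>, which is less than
  \<open>(s + 1) ^ (r + 1)\<close>.\<close>

lemma polynomial_growth:
  fixes a c r d :: nat
  assumes "r < d"
  shows "\<exists>s. c * (a * s + 1) ^ r < (s + 1) ^ d"
proof
  define s where "s = c * (a + 1) ^ r"
  have "(a * s + 1) ^ r \<le> ((a + 1) * (s + 1)) ^ r" by (intro power_mono) auto
  then have "c * (a * s + 1) ^ r \<le> c * ((a + 1) * (s + 1)) ^ r" by simp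
  also have "\<dots> = s * (s + 1) ^ r" by (simp only: s_def power_mult_distrib mult.assoc)
  also have "\<dots> < (s + 1) ^ Suc r" by simp
  also have "\<dots> \<le> (s + 1) ^ d" using assms by (intro power_increasing) auto
  finally show "c * (a * s + 1) ^ r < (s + 1) ^ d" .
qed

text \<open>Bounding each exponent, rather than the total degree, makes the number of monomials
  exactly \<open>(b + 1) ^ d\<close>. Degree at most \<open>b\<close> implies membership, and
  membership implies degree at most \<open>d * b\<close>.\<close>

definition monom_box :: "nat \<Rightarrow> nat \<Rightarrow> (nat \<Rightarrow>\<^sub>0 nat) set"
  where "monom_box d b = {m. Poly_Mapping.keys m \<subseteq> {1..d} \<and> (\<forall>i. Poly_Mapping.lookup m i \<le> b)}"

lemma bij_betw_monom_box:
  "bij_betw (\<lambda>m. restrict (Poly_Mapping.lookup m) {1..d}) (monom_box d b) ({1..d} \<rightarrow>\<^sub>E {..b})"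
proof (rule bij_betw_byWitness[where f' = "\<lambda>\<phi>. \<Sum>i\<in>{1..d}. Poly_Mapping.single i (\<phi> i)"])
  have lk: "Poly_Mapping.lookup (\<Sum>i\<in>{1..d}. Poly_Mapping.single i (\<phi> i)) k
    = (if k \<in> {1..d} then \<phi> k else 0)" for \<phi> :: "nat \<Rightarrow> nat" and k
    by (simp add: lookup_sum lookup_single when_def)
  show "\<forall>m\<in>monom_box d b. (\<Sum>i\<in>{1..d}. Poly_Mapping.single i (restrict (Poly_Mapping.lookup m) {1..d} i)) = m"
  proof
    fix m assume "m \<in> monom_box d b"
    then have "Poly_Mapping.lookup m k = 0" if "k \<notin> {1..d}" for k
      using that by (auto simp: monom_box_def in_keys_iff)
    then show "(\<Sum>i\<in>{1..d}. Poly_Mapping.single i (restrict (Poly_Mapping.lookup m) {1..d} i)) = m"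
      by (intro poly_mapping_eqI) (unfold lk, simp)
  qed
  show "\<forall>\<phi>\<in>{1..d} \<rightarrow>\<^sub>E {..b}.
    restrict (Poly_Mapping.lookup (\<Sum>i\<in>{1..d}. Poly_Mapping.single i (\<phi> i))) {1..d} = \<phi>"
    unfolding lk by (auto simp: fun_eq_iff PiE_def extensional_def)
  show "(\<lambda>m. restrict (Poly_Mapping.lookup m) {1..d}) ` monom_box d b \<subseteq> {1..d} \<rightarrow>\<^sub>E {..b}"
    by (auto simp: monom_box_def)
  show "(\<lambda>\<phi>. \<Sum>i\<in>{1..d}. Poly_Mapping.single i (\<phi> i)) ` ({1..d} \<rightarrow>\<^sub>E {..b}) \<subseteq> monom_box d b"
  proof (intro image_subsetI)
    fix \<phi> assume \<phi>: "\<phi> \<in> {1..d} \<rightarrow>\<^sub>E {..b}"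
    have "k \<in> {1..d}" if "k \<in> Poly_Mapping.keys (\<Sum>i\<in>{1..d}. Poly_Mapping.single i (\<phi> i))" for k
      using that unfolding in_keys_iff lk by presburger
    moreover have "(if k \<in> {1..d} then \<phi> k else 0) \<le> b" for k using \<phi> by auto
    ultimately show "(\<Sum>i\<in>{1..d}. Poly_Mapping.single i (\<phi> i)) \<in> monom_box d b"
      unfolding monom_box_def mem_Collect_eq lk by blast
  qed
qed

lemma finite_monom_box: "finite (monom_box d b)"
  using bij_betw_finite[OF bij_betw_monom_box, of d b] by (simp add: finite_PiE)

lemma card_monom_box: "card (monom_box d b) = (b + 1) ^ d"
  using bij_betw_same_card[OF bij_betw_monom_box, of d b] by (simp add: card_PiE)

lemma monom_degree_monom_box: "m \<in> monom_box d b \<Longrightarrow> monom_degree m \<le> d * b"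
  using sum_bounded_above[of "{1..d}" "Poly_Mapping.lookup m" b]
  by (simp add: monom_degree_superset[of "{1..d}"] monom_box_def)

lemma mem_monom_boxI:
  "f \<in> carrier (mpoly_ring d) \<Longrightarrow> m \<in> Poly_Mapping.keys f \<Longrightarrow> monom_degree m \<le> b \<Longrightarrow> m \<in> monom_box d b"
  by (auto simp: monom_box_def mem_carrier_mpoly_ring intro: order_trans[OF lookup_le_monom_degree])

text \<open>Letting a scalar act as a constant polynomial makes its compatibility with products an
  instance of associativity.\<close>

interpretation mpoly_vs: vector_space
  "\<lambda>c f. Poly_Mapping.single 0 c * f :: 'k::field mpoly"
  by unfold_locales
    (simp_all add: distrib_left distrib_right single_add mult_single mult.assoc[symmetric])

lemma mpoly_sum_monoms:
  fixes f :: "'k::field mpoly"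
  shows "f = (\<Sum>m\<in>Poly_Mapping.keys f. Poly_Mapping.single 0 (Poly_Mapping.lookup f m) * Poly_Mapping.single m 1)"
proof (rule poly_mapping_eqI)
  fix k
  show "Poly_Mapping.lookup f k = Poly_Mapping.lookup
    (\<Sum>m\<in>Poly_Mapping.keys f. Poly_Mapping.single 0 (Poly_Mapping.lookup f m) * Poly_Mapping.single m 1) k"
    by (cases "k \<in> Poly_Mapping.keys f")
      (simp_all add: mult_single lookup_sum lookup_single when_def in_keys_iff)
qed

lemma mem_span_monoms:
  fixes f :: "'k::field mpoly"
  shows "Poly_Mapping.keys f \<subseteq> M \<Longrightarrow> f \<in> mpoly_vs.span ((\<lambda>m. Poly_Mapping.single m 1) ` M)"
  by (subst mpoly_sum_monoms[of f]) (intro mpoly_vs.span_sum mpoly_vs.span_scale mpoly_vs.span_base, auto)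

lemma mpoly_span_mult:
  assumes "f \<in> mpoly_vs.span A" "\<And>a. a \<in> A \<Longrightarrow> a * g \<in> mpoly_vs.span B"
  shows "f * g \<in> mpoly_vs.span B"
  using assms(1)
proof (induction rule: mpoly_vs.span_induct_alt)
  case (step c x y)
  then show ?case
    using assms(2)[of x] 
    by (simp add: distrib_right mult.assoc mpoly_vs.span_add mpoly_vs.span_scale)
qed (simp add: mpoly_vs.span_zero)

text \<open>Products of powers of the \<open>F i\<close> with monomials from the box of side
  \<open>j\<close> span all forms. Those needed in degree \<open>n\<close> have exponents at most
  \<open>n\<close>, as the \<open>F i\<close> have positive degree, so there are at most
  \<open>(j + 1) ^ d * (n + 1) ^ r\<close> of them. For \<open>r < d\<close> this is too few to
  accommodate the \<open>(s + 1) ^ d\<close> independent monomials of a large box.\<close>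

lemma num_homogeneous_generators_ge:
  fixes F :: "nat \<Rightarrow> 'k::field mpoly"
  assumes F: "\<And>i. i < r \<Longrightarrow> F i \<in> mpoly_grading d (e i)" "\<And>i. i < r \<Longrightarrow> e i > 0"
    and j: "\<And>n. n \<ge> j \<Longrightarrow> mpoly_grading d n \<subseteq> lin_span d r F"
  shows "d \<le> r"
proof (rule ccontr)
  define T where "T n = (\<lambda>(\<beta>, m). (\<Prod>i<r. F i ^ \<beta> i) * Poly_Mapping.single m 1) `
    (({..<r} \<rightarrow>\<^sub>E {..n}) \<times> monom_box d j)" for n
  have finT: "finite (T n)" for n
    by (simp add: T_def finite_PiE finite_monom_box)
  have cardT: "card (T n) \<le> (j + 1) ^ d * (n + 1) ^ r" for n
  proof -
    have "card (T n) \<le> card (({..<r} \<rightarrow>\<^sub>E {..n}) \<times> monom_box d j)"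
      unfolding T_def by (intro card_image_le) (simp add: finite_PiE finite_monom_box)
    then show ?thesis by (simp add: card_cartesian_product card_monom_box card_PiE mult.commute)
  qed
  have T_mono: "T n \<subseteq> T n'" if "n \<le> n'" for n n'
    unfolding T_def using that by (intro image_mono Sigma_mono PiE_mono) auto
  \<comment> \<open>Monomials in \<open>F\<close> times monomials of bounded degree span: substitute \<open>f = \<Sum> a\<^sub>i F\<^sub>i\<close> repeatedly.\<close>
  have span: "f \<in> mpoly_vs.span (T n)" if "f \<in> mpoly_grading d n" for f n
    using that
  proof (induction n arbitrary: f rule: less_induct)
    case (less n)
    show ?case
    proof (cases "n < j")
      case True
      have "Poly_Mapping.keys f \<subseteq> monom_box d j"
        using less.prems True by (auto simp: mem_mpoly_grading homog_def intro!: mem_monom_boxI[of f])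
      moreover have "(\<lambda>m. Poly_Mapping.single m 1) ` monom_box d j \<subseteq> T n"
      proof safe
        fix m assume "m \<in> monom_box d j"
        then show "Poly_Mapping.single m 1 \<in> T n"
          unfolding T_def by (intro image_eqI[of _ _ "(\<lambda>i\<in>{..<r}. 0, m)"]) auto
      qed
      ultimately show ?thesis
        using mem_span_monoms mpoly_vs.span_mono by blast
    next
      case False
      then obtain a where a: "\<forall>i. a i \<in> carrier (mpoly_ring d)" "f = (\<Sum>i<r. a i * F i)"
        using j[of n] less.prems by (auto simp: lin_span_def)
      \<comment> \<open>The coefficients \<open>a i\<close> need not be homogeneous. Passing to
        degree \<open>n\<close> replaces them by their components of degree \<open>n - e i\<close>,
        to which the induction hypothesis applies.\<close>
      have "f = hcomp n f" using less.prems by (simp add: mem_mpoly_grading hcomp_homog[of n])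
      also have "\<dots> = (\<Sum>i<r. hcomp n (a i * F i))" by (simp add: a(2) hcomp_sum)
      also have "\<dots> \<in> mpoly_vs.span (T n)"
      proof (rule mpoly_vs.span_sum)
        fix i assume "i \<in> {..<r}"
        then have i: "i < r" "homog (e i) (F i)" using F by (auto simp: mem_mpoly_grading)
        have "hcomp (n - e i) (a i) * F i \<in> mpoly_vs.span (T n)" if le: "e i \<le> n"
        proof (rule mpoly_span_mult)
          show "hcomp (n - e i) (a i) \<in> mpoly_vs.span (T (n - e i))"
            using F(2)[OF i(1)] le a(1)
            by (intro less.IH) (auto simp: mem_mpoly_grading hcomp_carrier homog_hcomp)
          fix t assume "t \<in> T (n - e i)"
          then obtain \<beta> m where \<beta>: "\<beta> \<in> {..<r} \<rightarrow>\<^sub>E {..n - e i}" "m \<in> monom_box d j"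
            "t = (\<Prod>k<r. F k ^ \<beta> k) * Poly_Mapping.single m 1"
            by (auto simp: T_def)
          have "(\<Prod>k<r. F k ^ (\<beta>(i := Suc (\<beta> i))) k) = (\<Prod>k<r. F k ^ \<beta> k * (if k = i then F k else 1))"
            by (intro prod.cong refl) (simp add: mult.commute)
          also have "\<dots> = (\<Prod>k<r. F k ^ \<beta> k) * F i"
            using i(1) by (simp add: prod.distrib)
          finally have "t * F i = (\<Prod>k<r. F k ^ (\<beta>(i := Suc (\<beta> i))) k) * Poly_Mapping.single m 1"
            by (simp add: \<beta>(3) mult_ac)
          \<comment> \<open>The extra factor \<open>F i\<close> is paid for by the degree:
            \<open>\<beta> i <= n - e i\<close> and \<open>e i > 0\<close> give
            \<open>Suc (\<beta> i) <= n\<close>.\<close>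
          moreover have "\<beta>(i := Suc (\<beta> i)) \<in> {..<r} \<rightarrow>\<^sub>E {..n}"
          proof -
            have "\<beta> \<in> {..<r} \<rightarrow>\<^sub>E {..n}"
              using \<beta>(1) PiE_mono[of "{..<r}" "\<lambda>_. {..n - e i}" "\<lambda>_. {..n}"] by auto
            moreover have "Suc (\<beta> i) \<in> {..n}"
              using PiE_mem[OF \<beta>(1), of i] i(1) F(2)[OF i(1)] le by auto
            ultimately have "\<beta>(i := Suc (\<beta> i)) \<in> insert i {..<r} \<rightarrow>\<^sub>E {..n}"
              by (intro PiE_fun_upd)
            then show ?thesis using i(1) by (simp add: insert_absorb)
          qed
          ultimately have "t * F i \<in> T n"
            unfolding T_def using \<beta>(2) by (intro image_eqI[of _ _ "(\<beta>(i := Suc (\<beta> i)), m)"]) auto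
          then show "t * F i \<in> mpoly_vs.span (T n)" by (rule mpoly_vs.span_base)
        qed
        then show "hcomp n (a i * F i) \<in> mpoly_vs.span (T n)"
          by (simp add: hcomp_mult_homog[OF i(2)] mpoly_vs.span_zero)
      qed
      finally show ?thesis .
    qed
  qed
  assume "\<not> d \<le> r"
  \<comment> \<open>The monomials of the box of side \<open>s\<close> have degree at most
    \<open>d * s\<close>, so \<open>T (d * s)\<close> is the spanning set to compare with; this
    fixes the two constants.\<close>
  then obtain s where s: "(j + 1) ^ d * (d * s + 1) ^ r < (s + 1) ^ d"
    using polynomial_growth[of r d "(j + 1) ^ d" d] by auto
  have "\<exists>c. (\<exists>m\<in>monom_box d s. c m \<noteq> 0) \<and>
    (\<Sum>m\<in>monom_box d s. Poly_Mapping.single 0 (c m) * Poly_Mapping.single m 1) = (0 :: 'k mpoly)"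
  proof (rule mpoly_vs.ex_linear_relation)
    show "finite (T (d * s))" by (rule finT)
    show "card (T (d * s)) < card (monom_box d s)"
      using cardT[of "d * s"] s by (simp add: card_monom_box)
    fix m assume m: "m \<in> monom_box d s"
    have "(Poly_Mapping.single m 1 :: 'k mpoly) \<in> mpoly_grading d (monom_degree m)"
      using m by (auto simp: mem_mpoly_grading homog_def monom_box_def intro!: mpoly_carrier_single)
    then show "(Poly_Mapping.single m 1 :: 'k mpoly) \<in> mpoly_vs.span (T (d * s))"
      using span mpoly_vs.span_mono[OF T_mono[OF monom_degree_monom_box[OF m]]] by blast
  qed (rule finite_monom_box)
  then obtain c m where c: "m \<in> monom_box d s" "c m \<noteq> 0"
    "(\<Sum>m\<in>monom_box d s. Poly_Mapping.single 0 (c m) * Poly_Mapping.single m 1) = (0 :: 'k mpoly)"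
    by blast
  have "Poly_Mapping.lookup (\<Sum>m\<in>monom_box d s. Poly_Mapping.single 0 (c m) * Poly_Mapping.single m 1) m = c m"
    using c(1) finite_monom_box
    by (simp add: mult_single lookup_sum lookup_single when_def)
  with c(2,3) show False by simp
qed

section \<open>Algebraic dependence of \<open>d + 1\<close> polynomials in \<open>d\<close>
  variables\<close>

lemma keys_mult_degree_le:
  assumes "\<forall>m\<in>Poly_Mapping.keys f. monom_degree m \<le> a" "\<forall>m\<in>Poly_Mapping.keys g. monom_degree m \<le> b"
  shows "\<forall>m\<in>Poly_Mapping.keys (f * g). monom_degree m \<le> a + b"
  using assms Poly_Mapping.keys_mult[of f g] by (fastforce simp: monom_degree_add intro: add_mono)

lemma keys_power_degree_le:
  assumes "\<forall>m\<in>Poly_Mapping.keys f. monom_degree m \<le> a"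
  shows "\<forall>m\<in>Poly_Mapping.keys (f ^ n). monom_degree m \<le> n * a"
proof (induction n)
  case (Suc n)
  show ?case using keys_mult_degree_le[OF assms Suc] by simp
qed simp

lemma keys_prod_degree_le:
  assumes "\<And>i. i \<in> A \<Longrightarrow> \<forall>m\<in>Poly_Mapping.keys (f i). monom_degree m \<le> a"
  shows "\<forall>m\<in>Poly_Mapping.keys (prod f A). monom_degree m \<le> card A * a"
  using assms
proof (induction A rule: infinite_finite_induct)
  case (insert i A)
  then have "\<forall>m\<in>Poly_Mapping.keys (f i * prod f A). monom_degree m \<le> a + card A * a"
    by (intro keys_mult_degree_le) auto
  with insert.hyps show ?case by simp
qed auto

text \<open>If the polynomials have degree at most \<open>B\<close>, their
  \<open>(s + 1) ^ (d + 1)\<close> power products with exponents at most \<open>s\<close> have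
  degree at most \<open>(d + 1) * B * s\<close>, hence lie in the span of
  \<open>((d + 1) * B * s + 1) ^ d\<close> monomials, which is too small for suitable
  \<open>s\<close>. Extensionality ensures that distinct members of \<open>A\<close> are distinct
  exponent vectors.\<close>

lemma mpoly_algebraic_dependence:
  fixes x :: "nat \<Rightarrow> 'k::field mpoly"
  assumes x: "\<And>i. i < Suc d \<Longrightarrow> x i \<in> carrier (mpoly_ring d)"
  shows "\<exists>A c. finite A \<and> A \<noteq> {} \<and> A \<subseteq> extensional {..<Suc d} \<and> (\<forall>\<alpha>\<in>A. c \<alpha> \<noteq> 0) \<and>
    (\<Sum>\<alpha>\<in>A. Poly_Mapping.single 0 (c \<alpha>) * (\<Prod>i<Suc d. x i ^ \<alpha> i)) = 0"
proof -
  have "\<forall>i. \<exists>b. \<forall>m\<in>Poly_Mapping.keys (x i). monom_degree m \<le> b" using ex_degree_bound by blast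
  then obtain b where b: "\<And>i m. m \<in> Poly_Mapping.keys (x i) \<Longrightarrow> monom_degree m \<le> b i"
    by metis
  define B where "B = Max (b ` {..<Suc d})"
  have B: "\<forall>m\<in>Poly_Mapping.keys (x i). monom_degree m \<le> B" if "i < Suc d" for i
  proof -
    have "b i \<le> B" using that by (auto simp: B_def)
    then show ?thesis using b order_trans by blast
  qed
  obtain s where s: "1 * (Suc d * B * s + 1) ^ d < (s + 1) ^ Suc d"
    using polynomial_growth[of d "Suc d"] by blast
  define I where "I = ({..<Suc d} \<rightarrow>\<^sub>E {..s})"
  define T :: "'k mpoly set" where "T = (\<lambda>m. Poly_Mapping.single m 1) ` monom_box d (Suc d * B * s)"
  have "\<exists>c. (\<exists>\<alpha>\<in>I. c \<alpha> \<noteq> 0) \<and>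
    (\<Sum>\<alpha>\<in>I. Poly_Mapping.single 0 (c \<alpha>) * (\<Prod>i<Suc d. x i ^ \<alpha> i)) = 0"
  proof (rule mpoly_vs.ex_linear_relation)
    show "finite I" by (simp add: I_def finite_PiE)
    show "finite T" by (simp add: T_def finite_monom_box)
    have "card T \<le> (Suc d * B * s + 1) ^ d"
      unfolding T_def using card_image_le[OF finite_monom_box] by (metis card_monom_box)
    also have "\<dots> < card I" using s by (simp add: I_def card_PiE)
    finally show "card T < card I" .
    fix \<alpha> assume \<alpha>: "\<alpha> \<in> I"
    have "\<forall>m\<in>Poly_Mapping.keys (x i ^ \<alpha> i). monom_degree m \<le> s * B" if "i \<in> {..<Suc d}" for i
    proof -
      have "\<alpha> i * B \<le> s * B" using \<alpha> that by (auto simp: I_def)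
      then show ?thesis using keys_power_degree_le[OF B, of i "\<alpha> i"] that order_trans by blast
    qed
    then have "\<forall>m\<in>Poly_Mapping.keys (\<Prod>i<Suc d. x i ^ \<alpha> i). monom_degree m \<le> Suc d * B * s"
      using keys_prod_degree_le[of "{..<Suc d}" "\<lambda>i. x i ^ \<alpha> i" "s * B"]
      by (simp only: card_lessThan mult_ac ball_simps) blast
    moreover have "(\<Prod>i<Suc d. x i ^ \<alpha> i) \<in> carrier (mpoly_ring d)"
      using x by (intro mpoly_carrier_prod mpoly_carrier_power) auto
    ultimately show "(\<Prod>i<Suc d. x i ^ \<alpha> i) \<in> mpoly_vs.span T"
      unfolding T_def by (intro mem_span_monoms) (auto intro: mem_monom_boxI)
  qed
  then obtain c where c: "\<exists>\<alpha>\<in>I. c \<alpha> \<noteq> 0"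
    "(\<Sum>\<alpha>\<in>I. Poly_Mapping.single 0 (c \<alpha>) * (\<Prod>i<Suc d. x i ^ \<alpha> i)) = 0"
    by blast
  \<comment> \<open>Only the support of the relation is kept: selecting terms by a minimal exponent
    later must leave nonzero coefficients.\<close>
  define A where "A = {\<alpha>\<in>I. c \<alpha> \<noteq> 0}"
  have "finite I" by (simp add: I_def finite_PiE)
  then have finA: "finite A" by (simp add: A_def)
  from \<open>finite I\<close> have "(\<Sum>\<alpha>\<in>A. Poly_Mapping.single 0 (c \<alpha>) * (\<Prod>i<Suc d. x i ^ \<alpha> i)) = 0"
    unfolding A_def using c(2)
    by (subst sum.mono_neutral_left[where T = I]) auto
  moreover have "A \<noteq> {}" "A \<subseteq> extensional {..<Suc d}" "\<forall>\<alpha>\<in>A. c \<alpha> \<noteq> 0"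
    using c(1) by (auto simp: A_def I_def PiE_def)
  ultimately show ?thesis using finA by blast
qed

section \<open>Krull dimension\<close>

lemma enat_le_chain_length:
  assumes "\<And>i. i \<le> m \<Longrightarrow> C i \<in> F" "\<And>i. i < m \<Longrightarrow> C i \<subset> C (Suc i)"
  shows "enat m \<le> chain_length F"
  unfolding chain_length_def using assms by (intro Sup_upper) blast

lemma chain_length_leI:
  assumes "\<And>m C. (\<And>i. i \<le> m \<Longrightarrow> C i \<in> F) \<Longrightarrow> (\<And>i. i < m \<Longrightarrow> C i \<subset> C (Suc i)) \<Longrightarrow> enat m \<le> b"
  shows "chain_length F \<le> b"
  unfolding chain_length_def using assms by (intro Sup_least) blast

text \<open>The images under \<open>h\<close> of a chain in \<open>F\<close> form a chain in
  \<open>F'\<close> that \<open>Z\<close> prolongs at the bottom. The empty family also has chain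
  length 0, so \<open>F\<close> must be nonempty; this is also what lets \<open>eSuc\<close> commute
  with the supremum.\<close>

lemma eSuc_chain_length_le:
  assumes "F \<noteq> {}" and h: "\<And>A. A \<in> F \<Longrightarrow> h A \<in> F'"
    and mono: "\<And>A B. A \<in> F \<Longrightarrow> B \<in> F \<Longrightarrow> A \<subset> B \<Longrightarrow> h A \<subset> h B"
    and Z: "Z \<in> F'" "\<And>A. A \<in> F \<Longrightarrow> Z \<subset> h A"
  shows "eSuc (chain_length F) \<le> chain_length F'"
proof -
  let ?L = "{enat m |m. \<exists>C. (\<forall>i\<le>m. C i \<in> F) \<and> (\<forall>i<m. C i \<subset> C (Suc i))}"
  obtain A where "A \<in> F" using assms(1) by blast
  then have "\<exists>C. (\<forall>i\<le>0. C i \<in> F) \<and> (\<forall>i<0. C i \<subset> C (Suc i))" by (intro exI[of _ "\<lambda>_. A"]) auto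
  then have "?L \<noteq> {}" by blast
  then have "eSuc (chain_length F) = Sup (eSuc ` ?L)"
    unfolding chain_length_def by (rule eSuc_Sup)
  also have "\<dots> \<le> chain_length F'"
  proof (rule Sup_least)
    fix l assume "l \<in> eSuc ` ?L"
    then obtain m C where C: "l = enat (Suc m)" "\<forall>i\<le>m. C i \<in> F" "\<forall>i<m. C i \<subset> C (Suc i)"
      by (auto simp: eSuc_enat)
    show "l \<le> chain_length F'"
      unfolding C(1)
    proof (rule enat_le_chain_length[where C = "\<lambda>i. case i of 0 \<Rightarrow> Z | Suc j \<Rightarrow> h (C j)"])
      fix i assume "i \<le> Suc m"
      then show "(case i of 0 \<Rightarrow> Z | Suc j \<Rightarrow> h (C j)) \<in> F'"
        using Z(1) h C(2) by (cases i) auto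
    next
      fix i assume "i < Suc m"
      then show "(case i of 0 \<Rightarrow> Z | Suc j \<Rightarrow> h (C j)) \<subset> (case Suc i of 0 \<Rightarrow> Z | Suc j \<Rightarrow> h (C j))"
        using Z(2)[of "C 0"] C(2,3) mono[of "C (i - 1)" "C i"] by (cases i) auto
    qed
  qed
  finally show ?thesis .
qed

section \<open>Chains of primes in the polynomial ring\<close>

lemma primeideal_mpoly:
  assumes "primeideal p (mpoly_ring d)"
  shows "ideal p (mpoly_ring d)" "1 \<notin> p"
    "\<lbrakk>f \<in> carrier (mpoly_ring d); g \<in> carrier (mpoly_ring d); f * g \<in> p\<rbrakk> \<Longrightarrow> f \<in> p \<or> g \<in> p"
proof -
  interpret primeideal p "mpoly_ring d" by (rule assms)
  show "ideal p (mpoly_ring d)" by (rule ideal_axioms)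
  show "1 \<notin> p" using one_imp_carrier I_notcarr by auto
  show "\<lbrakk>f \<in> carrier (mpoly_ring d); g \<in> carrier (mpoly_ring d); f * g \<in> p\<rbrakk> \<Longrightarrow> f \<in> p \<or> g \<in> p"
    using I_prime[of f g] by simp
qed

lemma primeideal_mpoly_power:
  assumes p: "primeideal p (mpoly_ring d)"
    and f: "f \<in> carrier (mpoly_ring d)" "g \<in> carrier (mpoly_ring d)" "f ^ n * g \<in> p" "f \<notin> p"
  shows "g \<in> p"
  using f
proof (induction n)
  case (Suc n)
  then have "f * (f ^ n * g) \<in> p" by (simp add: mult_ac)
  then have "f \<in> p \<or> f ^ n * g \<in> p"
    using Suc.prems by (intro primeideal_mpoly(3)[OF p]) (auto intro!: mpoly_carrier_closed mpoly_carrier_power)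
  then show ?case using Suc by blast
qed simp

text \<open>
  Pulling out the lowest power of \<open>x\<^sub>k\<close> stays inside \<open>p\<^sub>k\<close>, as \<open>x\<^sub>k \<notin> p\<^sub>k\<close>, and the terms still divisible by
  \<open>x\<^sub>k\<close> vanish modulo \<open>p\<^bsub>k+1\<^esub>\<close>. The last variable eliminated, a nonzero constant remains.
\<close>
lemma mpoly_relation_not_in_prime_chain:
  fixes x :: "nat \<Rightarrow> 'k::field mpoly"
  assumes prime: "\<And>i. i \<le> N \<Longrightarrow> primeideal (p i) (mpoly_ring d)"
    and chain: "\<And>i. i < N \<Longrightarrow> p i \<subset> p (Suc i)"
    and x: "\<And>i. i < N \<Longrightarrow> x i \<in> p (Suc i) - p i"
    and k: "k \<le> N"
    and A: "finite A" "A \<noteq> {}" "A \<subseteq> extensional {..<N}"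
      "\<And>\<alpha> \<beta> i. \<alpha> \<in> A \<Longrightarrow> \<beta> \<in> A \<Longrightarrow> i < k \<Longrightarrow> \<alpha> i = \<beta> i"
    and c: "\<And>\<alpha>. \<alpha> \<in> A \<Longrightarrow> c \<alpha> \<noteq> 0"
  shows "(\<Sum>\<alpha>\<in>A. Poly_Mapping.single 0 (c \<alpha>) * (\<Prod>i=k..<N. x i ^ \<alpha> i)) \<notin> p k"
  using k A c
proof (induction k arbitrary: A rule: inc_induct)
  case base
  obtain \<alpha> where \<alpha>: "\<alpha> \<in> A" using base(2) by blast
  \<comment> \<open>Agreement of the exponents below \<open>k\<close> has become agreement at all
    indices; this is why it is carried through the induction.\<close>
  have "\<beta> = \<alpha>" if "\<beta> \<in> A" for \<beta>
  proof (rule extensionalityI)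
    show "\<alpha> \<in> extensional {..<N}" "\<beta> \<in> extensional {..<N}"
      using base(3) \<alpha> that by blast+
    show "\<beta> i = \<alpha> i" if "i \<in> {..<N}" for i
      using that by (intro base(4)[OF \<open>\<beta> \<in> A\<close> \<alpha>]) simp
  qed
  then have A: "A = {\<alpha>}" using \<alpha> by blast
  note pN = prime[OF order_refl]
  show ?case
  proof
    assume "(\<Sum>\<alpha>\<in>A. Poly_Mapping.single 0 (c \<alpha>) * (\<Prod>i=N..<N. x i ^ \<alpha> i)) \<in> p N"
    then have "Poly_Mapping.single 0 (c \<alpha>) \<in> p N" by (simp add: A)
    then have "Poly_Mapping.single 0 (inverse (c \<alpha>)) * Poly_Mapping.single 0 (c \<alpha>) \<in> p N"
      by (intro ideal_mpoly_mult[OF primeideal_mpoly(1)[OF pN]] mpoly_carrier_single) auto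
    then show False
      using base(5)[OF \<alpha>] primeideal_mpoly(2)[OF pN] by (simp add: mult_single)
  qed
next
  case (step k)
  note pk = prime[OF less_imp_le[OF step.hyps(2)]]
  have pSk: "primeideal (p (Suc k)) (mpoly_ring d)" using prime step.hyps by simp
  note idS = primeideal_mpoly(1)[OF pSk]
  have xc: "x i \<in> carrier (mpoly_ring d)" if "i < N" for i
    using x[OF that] ideal_mpoly_carrier[OF primeideal_mpoly(1)[OF prime[of "Suc i"]]] that by auto
  define m where "m = Min ((\<lambda>\<alpha>. \<alpha> k) ` A)"
  define A' where "A' = {\<alpha>\<in>A. \<alpha> k = m}"
  define t where "t \<alpha> = Poly_Mapping.single 0 (c \<alpha>) * (\<Prod>i=Suc k..<N. x i ^ \<alpha> i)" for \<alpha>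
  have tc: "t \<alpha> \<in> carrier (mpoly_ring d)" for \<alpha>
    unfolding t_def using xc
    by (intro mpoly_carrier_closed(2) mpoly_carrier_prod mpoly_carrier_power mpoly_carrier_single) auto
  have m: "m \<le> \<alpha> k" if "\<alpha> \<in> A" for \<alpha>
    using step.prems(1) that by (auto simp: m_def)
  have "m \<in> (\<lambda>\<alpha>. \<alpha> k) ` A" unfolding m_def using step.prems(1,2) by (intro Min_in) auto
  then have A': "A' \<noteq> {}" "finite A'" "A' \<subseteq> A" using step.prems(1) by (auto simp: A'_def)
  have "(\<Sum>\<alpha>\<in>A. Poly_Mapping.single 0 (c \<alpha>) * (\<Prod>i=k..<N. x i ^ \<alpha> i))
    = (\<Sum>\<alpha>\<in>A. x k ^ m * (x k ^ (\<alpha> k - m) * t \<alpha>))"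
  proof (intro sum.cong refl)
    fix \<alpha> assume "\<alpha> \<in> A"
    then have "x k ^ \<alpha> k = x k ^ m * x k ^ (\<alpha> k - m)"
      using m[of \<alpha>] by (simp flip: power_add)
    then show "Poly_Mapping.single 0 (c \<alpha>) * (\<Prod>i=k..<N. x i ^ \<alpha> i) = x k ^ m * (x k ^ (\<alpha> k - m) * t \<alpha>)"
      using step.hyps(2) by (simp add: t_def prod.atLeast_Suc_lessThan mult_ac)
  qed
  also have "\<dots> = x k ^ m * (\<Sum>\<alpha>\<in>A. x k ^ (\<alpha> k - m) * t \<alpha>)" by (simp add: sum_distrib_left)
  finally have eq: "(\<Sum>\<alpha>\<in>A. Poly_Mapping.single 0 (c \<alpha>) * (\<Prod>i=k..<N. x i ^ \<alpha> i))
    = x k ^ m * (\<Sum>\<alpha>\<in>A. x k ^ (\<alpha> k - m) * t \<alpha>)" .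
  show ?case
  proof
    assume "(\<Sum>\<alpha>\<in>A. Poly_Mapping.single 0 (c \<alpha>) * (\<Prod>i=k..<N. x i ^ \<alpha> i)) \<in> p k"
    then have "x k ^ m * (\<Sum>\<alpha>\<in>A. x k ^ (\<alpha> k - m) * t \<alpha>) \<in> p k" by (simp only: eq)
    moreover have "(\<Sum>\<alpha>\<in>A. x k ^ (\<alpha> k - m) * t \<alpha>) \<in> carrier (mpoly_ring d)"
      by (intro mpoly_carrier_sum mpoly_carrier_closed(2) mpoly_carrier_power xc step.hyps(2) tc)
    moreover have "x k \<notin> p k" using x[OF step.hyps(2)] by simp
    ultimately have "(\<Sum>\<alpha>\<in>A. x k ^ (\<alpha> k - m) * t \<alpha>) \<in> p k"
      using primeideal_mpoly_power[OF pk xc[OF step.hyps(2)]] by blast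
    then have 1: "(\<Sum>\<alpha>\<in>A. x k ^ (\<alpha> k - m) * t \<alpha>) \<in> p (Suc k)"
      using chain[OF step.hyps(2)] by blast
    have 2: "(\<Sum>\<alpha>\<in>A - A'. x k ^ (\<alpha> k - m) * t \<alpha>) \<in> p (Suc k)"
    proof (rule ideal_mpoly_sum[OF idS])
      fix \<alpha> assume "\<alpha> \<in> A - A'"
      then obtain l where l: "\<alpha> k - m = Suc l"
        using m[of \<alpha>] by (cases "\<alpha> k - m") (auto simp: A'_def)
      have "(x k ^ l * t \<alpha>) * x k \<in> p (Suc k)"
        using x[OF step.hyps(2)] xc[OF step.hyps(2)] tc
        by (intro ideal_mpoly_mult[OF idS] mpoly_carrier_closed(2) mpoly_carrier_power) auto
      then show "x k ^ (\<alpha> k - m) * t \<alpha> \<in> p (Suc k)" by (simp add: l mult_ac)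
    qed
    have "(\<Sum>\<alpha>\<in>A'. t \<alpha>) = (\<Sum>\<alpha>\<in>A'. x k ^ (\<alpha> k - m) * t \<alpha>)"
      by (intro sum.cong refl) (simp add: A'_def)
    also have "\<dots> = (\<Sum>\<alpha>\<in>A. x k ^ (\<alpha> k - m) * t \<alpha>) - (\<Sum>\<alpha>\<in>A - A'. x k ^ (\<alpha> k - m) * t \<alpha>)"
      using sum.subset_diff[OF A'(3) step.prems(1), of "\<lambda>\<alpha>. x k ^ (\<alpha> k - m) * t \<alpha>"] by simp
    also have "\<dots> \<in> p (Suc k)" by (rule ideal_mpoly_diff[OF idS 1 2])
    finally have "(\<Sum>\<alpha>\<in>A'. t \<alpha>) \<in> p (Suc k)" .
    moreover have "(\<Sum>\<alpha>\<in>A'. t \<alpha>) \<notin> p (Suc k)"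
      unfolding t_def
    proof (rule step.IH)
      fix \<alpha> \<beta> i assume "\<alpha> \<in> A'" "\<beta> \<in> A'" "i < Suc k"
      then show "\<alpha> i = \<beta> i" using step.prems(4)[of \<alpha> \<beta> i] by (cases "i = k") (auto simp: A'_def)
    qed (use A' step.prems(3,5) in auto)
    ultimately show False by contradiction
  qed
qed

text \<open>From a longer chain, pick an element of \<open>C (Suc i)\<close> outside
  \<open>C i\<close> for each of the first \<open>d + 1\<close> steps. Their algebraic relation has
  value 0, which lies in \<open>C 0\<close>, but the preceding lemma at \<open>k = 0\<close>
  excludes it from there.\<close>

theorem krull_dim_mpoly_ring_le: "krull_dim (mpoly_ring d :: 'k::field mpoly ring) \<le> enat d"
  unfolding krull_dim_def
proof (rule chain_length_leI)
  fix m and C :: "nat \<Rightarrow> 'k mpoly set"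
  assume C: "\<And>i. i \<le> m \<Longrightarrow> C i \<in> {p. primeideal p (mpoly_ring d)}" "\<And>i. i < m \<Longrightarrow> C i \<subset> C (Suc i)"
  show "enat m \<le> enat d"
  proof (rule ccontr)
    assume "\<not> enat m \<le> enat d"
    then have m: "Suc d \<le> m" by simp
    have "\<forall>i. \<exists>y. i < m \<longrightarrow> y \<in> C (Suc i) - C i" using C(2) by blast
    then obtain x where x: "\<And>i. i < m \<Longrightarrow> x i \<in> C (Suc i) - C i" by metis
    have "x i \<in> carrier (mpoly_ring d)" if "i < Suc d" for i
    proof -
      have "primeideal (C (Suc i)) (mpoly_ring d)" using C(1)[of "Suc i"] m that by simp
      then show ?thesis
        using x[of i] m that by (intro ideal_mpoly_carrier[OF primeideal_mpoly(1)]) auto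
    qed
    then obtain A c where A: "finite A" "A \<noteq> {}" "A \<subseteq> extensional {..<Suc d}" "\<forall>\<alpha>\<in>A. c \<alpha> \<noteq> 0"
      "(\<Sum>\<alpha>\<in>A. Poly_Mapping.single 0 (c \<alpha>) * (\<Prod>i<Suc d. x i ^ \<alpha> i)) = 0"
      using mpoly_algebraic_dependence[of d x] by blast
    have "(\<Sum>\<alpha>\<in>A. Poly_Mapping.single 0 (c \<alpha>) * (\<Prod>i=0..<Suc d. x i ^ \<alpha> i)) \<notin> C 0"
    proof (rule mpoly_relation_not_in_prime_chain[where N = "Suc d"])
      show "primeideal (C i) (mpoly_ring d)" if "i \<le> Suc d" for i
        using C(1)[of i] that m by simp
      show "C i \<subset> C (Suc i)" "x i \<in> C (Suc i) - C i" if "i < Suc d" for i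
        using C(2)[of i] x[of i] that m by simp_all
    qed (use A(1-4) in auto)
    moreover have "0 \<in> C 0"
      using C(1)[of 0] ideal_mpoly_0[OF primeideal_mpoly(1), of "C 0" d] by simp
    ultimately show False using A(5) by (simp add: lessThan_atLeast0)
  qed
qed

lemma primeideal_mpoly_zero: "primeideal {0} (mpoly_ring d :: 'k::field mpoly ring)"
proof (rule primeidealI)
  show "ideal {0} (mpoly_ring d :: 'k mpoly ring)" by (rule ideal_mpolyI) simp_all
  show "carrier (mpoly_ring d) \<noteq> {0 :: 'k mpoly}"
  proof
    assume "carrier (mpoly_ring d) = {0 :: 'k mpoly}"
    then have "(1 :: 'k mpoly) \<in> {0}" using mpoly_carrier_0_1(2)[of d] by metis
    then show False by simp
  qed
next
  fix a b :: "'k mpoly" assume "a \<otimes>\<^bsub>mpoly_ring d\<^esub> b \<in> {0}"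
  then show "a \<in> {0} \<or> b \<in> {0}" by simp
qed (rule cring_mpoly_ring)

section \<open>Quotient rings\<close>

lemma carrier_Quot: "carrier (R Quot I) = (\<lambda>a. I +>\<^bsub>R\<^esub> a) ` carrier R"
  by (auto simp: FactRing_def A_RCOSETS_def')

lemma zero_Quot: "\<zero>\<^bsub>R Quot I\<^esub> = I"
  by (simp add: FactRing_def)

text \<open>The contraction of a set of cosets. Through it prime chains move from the quotient to
  \<open>R\<close>, and membership in ideals of the quotient is tested on representatives.\<close>

definition quot_vimage :: "('a, 'b) ring_scheme \<Rightarrow> 'a set \<Rightarrow> 'a set set \<Rightarrow> 'a set"
  where "quot_vimage R I A = {a \<in> carrier R. I +>\<^bsub>R\<^esub> a \<in> A}"

context cring
begin

lemma mult_Quot: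
  "ideal I R \<Longrightarrow> a \<in> carrier R \<Longrightarrow> b \<in> carrier R \<Longrightarrow>
    (I +> a) \<otimes>\<^bsub>R Quot I\<^esub> (I +> b) = I +> a \<otimes> b"
  by (simp add: FactRing_def ideal.rcoset_mult_add)

lemma ideal_quot_vimage:
  "ideal I R \<Longrightarrow> ideal A (R Quot I) \<Longrightarrow> ideal (quot_vimage R I A) R"
  unfolding quot_vimage_def
  by (rule ring_hom_ring.ideal_vimage[OF ideal.rcos_ring_hom_ring])

lemma quot_vimage_superset:
  assumes I: "ideal I R" and A: "ideal A (R Quot I)"
  shows "I \<subseteq> quot_vimage R I A"
proof
  fix a assume a: "a \<in> I"
  have "I \<in> A"
    using additive_subgroup.zero_closed[OF ideal.axioms(1)[OF A]] by (simp add: zero_Quot)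
  then show "a \<in> quot_vimage R I A"
    using a a_rcos_zero[OF I a] ideal.Icarr[OF I a] by (simp add: quot_vimage_def)
qed

lemma quot_vimage_strict_mono:
  "B \<subseteq> carrier (R Quot I) \<Longrightarrow> A \<subset> B \<Longrightarrow> quot_vimage R I A \<subset> quot_vimage R I B"
  unfolding carrier_Quot quot_vimage_def by blast

lemma primeideal_quot_vimage:
  assumes I: "ideal I R" and A: "primeideal A (R Quot I)"
  shows "primeideal (quot_vimage R I A) R"
proof (rule primeidealI)
  interpret A: primeideal A "R Quot I" by (rule A)
  show "ideal (quot_vimage R I A) R" by (rule ideal_quot_vimage[OF I A.ideal_axioms])
  show "carrier R \<noteq> quot_vimage R I A"
    using A.I_notcarr A.a_subset unfolding carrier_Quot quot_vimage_def by blast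
  fix a b assume ab: "a \<in> carrier R" "b \<in> carrier R" "a \<otimes> b \<in> quot_vimage R I A"
  then have "(I +> a) \<otimes>\<^bsub>R Quot I\<^esub> (I +> b) \<in> A"
    by (simp add: mult_Quot[OF I] quot_vimage_def)
  then show "a \<in> quot_vimage R I A \<or> b \<in> quot_vimage R I A"
    using A.I_prime[of "I +> a" "I +> b"] ab by (auto simp: quot_vimage_def carrier_Quot)
qed (rule is_cring)

text \<open>As \<open>I\<close> is contained in \<open>J\<close>, the ideal \<open>J\<close> is a
  union of cosets of \<open>I\<close>, so membership of a coset in the image does not depend on the
  representative.\<close>

lemma quot_image_memD:
  assumes I: "ideal I R" and J: "ideal J R" "I \<subseteq> J"
    and a: "a \<in> carrier R" "I +> a \<in> (+>) I ` J"
  shows "a \<in> J"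
proof -
  obtain b where b: "b \<in> J" "I +> a = I +> b" using a(2) by blast
  then have "a \<ominus> b \<in> J"
    using quotient_eq_iff_same_a_r_cos[OF I a(1) ideal.Icarr[OF J(1)]] J(2) by blast
  then have "(a \<ominus> b) \<oplus> b \<in> J"
    using additive_subgroup.a_closed[OF ideal.axioms(1)[OF J(1)]] b(1) by blast
  moreover have "(a \<ominus> b) \<oplus> b = a"
    using a(1) ideal.Icarr[OF J(1) b(1)] by algebra
  ultimately show ?thesis by simp
qed

lemma primeideal_quot_image:
  assumes I: "ideal I R" and P: "primeideal P R" and sub: "I \<subseteq> P"
  shows "primeideal ((+>) I ` P) (R Quot I)"
proof (rule primeidealI)
  interpret P: primeideal P R by (rule P)
  note mem = quot_image_memD[OF I P.ideal_axioms sub]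
  show "ideal ((+>) I ` P) (R Quot I)" by (rule ring_ideal_imp_quot_ideal[OF I P.ideal_axioms])
  show "cring (R Quot I)" by (rule ideal.quotient_is_cring[OF I is_cring])
  show "carrier (R Quot I) \<noteq> (+>) I ` P"
  proof
    assume "carrier (R Quot I) = (+>) I ` P"
    then have "\<one> \<in> P" by (intro mem) (auto simp: carrier_Quot)
    then show False using P.one_imp_carrier P.I_notcarr by blast
  qed
  fix x y
  assume x: "x \<in> carrier (R Quot I)" and y: "y \<in> carrier (R Quot I)"
    and xy: "x \<otimes>\<^bsub>R Quot I\<^esub> y \<in> (+>) I ` P"
  obtain a b where ab: "a \<in> carrier R" "b \<in> carrier R" "x = I +> a" "y = I +> b"
    using x y by (auto simp: carrier_Quot)
  have "a \<otimes> b \<in> P" using xy ab by (intro mem) (simp_all add: mult_Quot[OF I])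
  then show "x \<in> (+>) I ` P \<or> y \<in> (+>) I ` P" using P.I_prime ab by blast
qed

text \<open>Contracted chains start at a prime containing \<open>I\<close>, hence strictly above
  \<open>Z\<close>, which prolongs them. The prime \<open>q\<close> witnesses that the quotient has
  a nonempty spectrum; the zero ring would have dimension 0 as well.\<close>

lemma eSuc_krull_dim_Quot_le:
  assumes I: "ideal I R" and q: "primeideal q (R Quot I)" and Z: "primeideal Z R"
    and lt: "\<And>p. primeideal p R \<Longrightarrow> I \<subseteq> p \<Longrightarrow> Z \<subset> p"
  shows "eSuc (krull_dim (R Quot I)) \<le> krull_dim R"
  unfolding krull_dim_def
proof (rule eSuc_chain_length_le[where h = "quot_vimage R I" and Z = Z])
  show "{p. primeideal p (R Quot I)} \<noteq> {}" using q by blast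
  show "Z \<in> {p. primeideal p R}" using Z by simp
  fix A assume "A \<in> {p. primeideal p (R Quot I)}"
  then have A: "primeideal A (R Quot I)" by simp
  show "quot_vimage R I A \<in> {p. primeideal p R}"
    using primeideal_quot_vimage[OF I A] by simp
  show "Z \<subset> quot_vimage R I A"
    by (rule lt[OF primeideal_quot_vimage[OF I A] quot_vimage_superset[OF I primeideal.axioms(1)[OF A]]])
next
  fix A B assume "A \<in> {p. primeideal p (R Quot I)}" "B \<in> {p. primeideal p (R Quot I)}" "A \<subset> B"
  then show "quot_vimage R I A \<subset> quot_vimage R I B"
    using additive_subgroup.a_subset[OF ideal.axioms(1)[OF primeideal.axioms(1)]]
    by (intro quot_vimage_strict_mono) auto
qed

lemma submodule_quot_module:
  assumes K: "ideal K R" and B: "ideal B (R Quot K)"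
  shows "submodule B R (quot_module R K)"
proof -
  interpret B: ideal B "R Quot K" by (rule B)
  show ?thesis
  proof (intro submodule.intro submodule_axioms.intro)
    show "subgroup B (add_monoid (quot_module R K))"
      using B.a_subgroup by (simp add: subgroup_def m_inv_def quot_module_def ring.defs module.defs)
    show "a \<odot>\<^bsub>quot_module R K\<^esub> x \<in> B" if "a \<in> carrier R" "x \<in> B" for a x
      using that by (auto simp: quot_module_def ring.defs module.defs carrier_Quot intro!: B.I_l_closed)
  qed
qed

end

section \<open>Ideals of finite colength\<close>

text \<open>If no step were stationary, the first \<open>l + 1\<close> steps read backwards would
  form an ascending chain exceeding the length \<open>l\<close>.\<close>

lemma finite_length_decseq_stable:
  fixes N :: "nat \<Rightarrow> 'b set"
  assumes fin: "module_length R M < \<infinity>" and N: "\<And>i. submodule (N i) R M" "\<And>i. N (Suc i) \<subseteq> N i"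
  shows "\<exists>i. N (Suc i) = N i"
proof (rule ccontr)
  assume "\<nexists>i. N (Suc i) = N i"
  then have lt: "N (Suc i) \<subset> N i" for i using N(2)[of i] by blast
  obtain l where l: "module_length R M = enat l" using fin by auto
  have "enat (Suc l) \<le> module_length R M"
    unfolding module_length_def
  proof (rule enat_le_chain_length[where C = "\<lambda>i. N (Suc l - i)"])
    fix i assume "i < Suc l"
    then have "Suc l - i = Suc (Suc l - Suc i)" by simp
    then show "N (Suc l - i) \<subset> N (Suc l - Suc i)" using lt[of "Suc l - Suc i"] by metis
  qed (use N(1) in simp)
  with l show False by simp
qed

text \<open>The \<open>i\<close>-th power of the irrelevant ideal, described by the absence of terms
  of degree below \<open>i\<close>.\<close>

definition order_ideal :: "nat \<Rightarrow> nat \<Rightarrow> 'k::field mpoly set"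
  where "order_ideal d i = {f \<in> carrier (mpoly_ring d). \<forall>j<i. hcomp j f = 0}"

lemma ideal_order_ideal: "ideal (order_ideal d i) (mpoly_ring d)"
proof (rule ideal_mpolyI)
  fix f g :: "'a mpoly"
  assume f: "f \<in> carrier (mpoly_ring d)" and g: "g \<in> order_ideal d i"
  have "hcomp j (f * g) = 0" if "j < i" for j
    unfolding hcomp_mult
  proof (rule sum.neutral, rule ballI)
    fix l
    have "j - l < i" using that by simp
    then show "hcomp l f * hcomp (j - l) g = 0" using g by (simp add: order_ideal_def)
  qed
  then show "f * g \<in> order_ideal d i"
    using f g by (simp add: order_ideal_def mpoly_carrier_closed(2))
next
  fix f g :: "'a mpoly"
  assume "f \<in> order_ideal d i" "g \<in> order_ideal d i"
  then show "f + g \<in> order_ideal d i"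
    by (simp add: order_ideal_def hcomp_add mpoly_carrier_closed(1))
qed (simp_all add: order_ideal_def)

text \<open>The images of the order ideals descend in a module of finite length. Where they are
  stationary, a form \<open>f\<close> of degree \<open>i\<close> agrees modulo the preimage of
  \<open>K\<close> with some \<open>g\<close> of order above \<open>i\<close>; then
  \<open>f - g\<close> lies in the homogeneous ideal \<open>J\<close>, and its component of degree
  \<open>i\<close> is \<open>f\<close>.\<close>

lemma finite_length_contains_degree:
  fixes I J :: "'k::field mpoly set" and d :: nat
  defines "R \<equiv> mpoly_ring d Quot I"
  assumes I: "ideal I (mpoly_ring d)" and J: "homog_ideal d J" and K: "ideal K R"
    and sub: "quot_vimage (mpoly_ring d) I K \<subseteq> J"
    and fin: "module_length R (quot_module R K) < \<infinity>"
  shows "\<exists>i. mpoly_grading d i \<subseteq> J"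
proof -
  interpret S: cring "mpoly_ring d :: 'k mpoly ring" by (rule cring_mpoly_ring)
  interpret R: cring R unfolding R_def by (rule ideal.quotient_is_cring[OF I S.is_cring])
  interpret h: ring_hom_ring "mpoly_ring d" R "(+>\<^bsub>mpoly_ring d\<^esub>) I"
    unfolding R_def by (rule ideal.rcos_ring_hom_ring[OF I])
  define N where "N i = (+>\<^bsub>R\<^esub>) K ` (+>\<^bsub>mpoly_ring d\<^esub>) I ` order_ideal d i" for i
  have "\<exists>i. N (Suc i) = N i"
  proof (rule finite_length_decseq_stable[OF fin])
    fix i
    show "submodule (N i) R (quot_module R K)"
      unfolding N_def
      by (intro R.submodule_quot_module K R.ring_ideal_imp_quot_ideal)
        (unfold R_def, intro S.ring_ideal_imp_quot_ideal I ideal_order_ideal)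
    show "N (Suc i) \<subseteq> N i"
      unfolding N_def by (intro image_mono) (auto simp: order_ideal_def)
  qed
  then obtain i where i: "N (Suc i) = N i" by blast
  have "f \<in> J" if f: "f \<in> mpoly_grading d i" for f
  proof -
    have "f \<in> order_ideal d i" using f by (simp add: order_ideal_def mem_mpoly_grading hcomp_homog[of i])
    then have "K +>\<^bsub>R\<^esub> (I +>\<^bsub>mpoly_ring d\<^esub> f) \<in> N (Suc i)"
      unfolding i by (simp add: N_def)
    then obtain g where g: "g \<in> order_ideal d (Suc i)"
      "K +>\<^bsub>R\<^esub> (I +>\<^bsub>mpoly_ring d\<^esub> f) = K +>\<^bsub>R\<^esub> (I +>\<^bsub>mpoly_ring d\<^esub> g)"
      by (auto simp: N_def)
    have fc: "f \<in> carrier (mpoly_ring d)" and gc: "g \<in> carrier (mpoly_ring d)"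
      using f g(1) by (simp_all add: mem_mpoly_grading order_ideal_def)
    have "(I +>\<^bsub>mpoly_ring d\<^esub> f) \<ominus>\<^bsub>R\<^esub> (I +>\<^bsub>mpoly_ring d\<^esub> g) \<in> K"
      using R.quotient_eq_iff_same_a_r_cos[OF K h.hom_closed[OF fc] h.hom_closed[OF gc]] g(2) by simp
    also have "(I +>\<^bsub>mpoly_ring d\<^esub> f) \<ominus>\<^bsub>R\<^esub> (I +>\<^bsub>mpoly_ring d\<^esub> g)
      = I +>\<^bsub>mpoly_ring d\<^esub> (f \<ominus>\<^bsub>mpoly_ring d\<^esub> g)"
      unfolding a_minus_def h.hom_a_inv[OF gc, symmetric] h.hom_add[OF fc S.a_inv_closed[OF gc]] ..
    also have "f \<ominus>\<^bsub>mpoly_ring d\<^esub> g = f - g"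
      by (simp add: a_minus_def a_inv_mpoly_ring[OF gc])
    finally have "f - g \<in> J"
      using sub mpoly_carrier_closed(3)[OF fc gc] by (auto simp: quot_vimage_def)
    then have "hcomp i (f - g) \<in> J" by (rule homog_idealD(2)[OF J])
    moreover have "hcomp i (f - g) = f"
    proof -
      have "hcomp i (f - g) + hcomp i g = hcomp i f" by (simp flip: hcomp_add)
      then show ?thesis
        using g(1) f by (simp add: order_ideal_def mem_mpoly_grading hcomp_homog[of i])
    qed
    ultimately show ?thesis by simp
  qed
  then show ?thesis by blast
qed

text \<open>Every monomial of degree \<open>i + 1\<close> is a variable times a monomial of degree
  \<open>i\<close>.\<close>

lemma mpoly_grading_subset_ideal_Suc:
  fixes J :: "'k::field mpoly set"
  assumes J: "ideal J (mpoly_ring d)" and sub: "mpoly_grading d i \<subseteq> J"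
  shows "mpoly_grading d (Suc i) \<subseteq> J"
proof
  fix f :: "'k mpoly" assume f: "f \<in> mpoly_grading d (Suc i)"
  have "Poly_Mapping.single m 1 \<in> J" if m: "m \<in> Poly_Mapping.keys f" for m
  proof -
    have md: "monom_degree m = Suc i" and mk: "Poly_Mapping.keys m \<subseteq> {1..d}"
      using f m by (auto simp: mem_mpoly_grading homog_def mem_carrier_mpoly_ring)
    then have "m \<noteq> 0" by auto
    then obtain k where k: "k \<in> Poly_Mapping.keys m" by fastforce
    define m' where "m' = m - Poly_Mapping.single k 1"
    have m': "m = Poly_Mapping.single k 1 + m'"
      using k by (intro poly_mapping_eqI)
        (auto simp: m'_def lookup_add lookup_minus lookup_single when_def in_keys_iff)
    then have "monom_degree m' = i" using md monom_degree_add[of "Poly_Mapping.single k 1" m'] by simp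
    moreover have "Poly_Mapping.keys m' \<subseteq> Poly_Mapping.keys m"
      by (auto simp: m'_def in_keys_iff lookup_minus)
    ultimately have "Poly_Mapping.single m' 1 \<in> mpoly_grading d i"
      using mk by (auto simp: mem_mpoly_grading homog_def intro!: mpoly_carrier_single)
    moreover have "Poly_Mapping.single (Poly_Mapping.single k 1) 1 \<in> carrier (mpoly_ring d)"
      using k mk by (intro mpoly_carrier_single) auto
    ultimately have "Poly_Mapping.single (Poly_Mapping.single k 1) 1 * Poly_Mapping.single m' (1 :: 'k) \<in> J"
      using sub by (intro ideal_mpoly_mult[OF J]) auto
    then show ?thesis by (simp only: mult_single m'[symmetric] mult_1)
  qed
  then show "f \<in> J"
    by (subst mpoly_sum_monoms[of f])
      (intro ideal_mpoly_sum[OF J] ideal_mpoly_mult[OF J] mpoly_carrier_single, auto)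
qed

lemma mpoly_grading_subset_ideal_ge:
  assumes "ideal J (mpoly_ring d)" "mpoly_grading d i \<subseteq> J" "i \<le> n"
  shows "mpoly_grading d n \<subseteq> J"
  using assms(3)
  by (induction n rule: dec_induct) (intro assms(2) mpoly_grading_subset_ideal_Suc[OF assms(1)])+

section \<open>Annihilators and ideals generated by systems of parameters\<close>

theorem proposition2p17:
  fixes d n :: nat
    and S :: "((nat \<Rightarrow>\<^sub>0 nat) \<Rightarrow>\<^sub>0 'k::field) ring"
    and P :: "((nat \<Rightarrow>\<^sub>0 nat) \<Rightarrow>\<^sub>0 'k) set"
    and R :: "((nat \<Rightarrow>\<^sub>0 nat) \<Rightarrow>\<^sub>0 'k) set ring"
    and G :: "nat \<Rightarrow> ((nat \<Rightarrow>\<^sub>0 nat) \<Rightarrow>\<^sub>0 'k) set set"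
    and \<qq> :: "((nat \<Rightarrow>\<^sub>0 nat) \<Rightarrow>\<^sub>0 'k) set set"
    and u :: "((nat \<Rightarrow>\<^sub>0 nat) \<Rightarrow>\<^sub>0 'k) set"
  assumes S: "S = mpoly_ring d"
    and P: "primeideal P S" "\<exists>L \<subseteq> linear_forms d. P = Idl\<^bsub>S\<^esub> L"
    and n: "n > 0"
    and R: "R = S Quot (P [^]\<^bsub>ideals_set S\<^esub> n)"
    and G: "G = quot_grading S (mpoly_grading d) (P [^]\<^bsub>ideals_set S\<^esub> n)"
    and q: "\<qq> \<in> Assh R"
    and u: "u \<in> \<qq>"
  shows "\<not> (\<exists>xs. hsop R G xs \<and> annihilator R u \<subseteq> Idl\<^bsub>R\<^esub> (set xs))"
proof
  assume "\<exists>xs. hsop R G xs \<and> annihilator R u \<subseteq> Idl\<^bsub>R\<^esub> (set xs)"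
  then obtain xs where xs: "hsop R G xs" and ann: "annihilator R u \<subseteq> Idl\<^bsub>R\<^esub> (set xs)" by blast
  \<comment> \<open>For \<open>n = 1\<close> the exponent \<open>m\<close> is 0 and \<open>M\<close>
    below is the whole ring, the unit of the monoid of ideals; no separate case arises.\<close>
  obtain m where m: "n = Suc m" using n gr0_implies_Suc by blast
  define I where "I = P [^]\<^bsub>ideals_set S\<^esub> n"
  define M where "M = P [^]\<^bsub>ideals_set S\<^esub> m"
  define r where "r = length xs"
  define K where "K = Idl\<^bsub>R\<^esub> (set xs)"
  interpret S: cring S unfolding S by (rule cring_mpoly_ring)
  interpret P: primeideal P S by (rule P(1))

  have homP: "homog_ideal d P" and P_irr: "P \<subseteq> irrelevant_ideal d"
  proof -
    obtain L where L: "L \<subseteq> linear_forms d" "P = Idl\<^bsub>S\<^esub> L" using P(2) by blast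
    show "homog_ideal d P" unfolding L(2) S by (rule homog_ideal_genideal) (use L(1) in blast)
    have "L \<subseteq> irrelevant_ideal d" using L(1) mpoly_grading_subset_irrelevant_ideal[of 1 d] by auto
    then show "P \<subseteq> irrelevant_ideal d"
      unfolding L(2) using S.genideal_minimal[of "irrelevant_ideal d" L] ideal_irrelevant_ideal[of d] 
      by (simp add: S)
  qed
  have homI: "homog_ideal d I" and homM: "homog_ideal d M"
    unfolding I_def M_def S by (rule homog_ideal_pow[OF homP])+
  have idI: "ideal I S" and idM: "ideal M S"
    using homog_idealD(1)[OF homI] homog_idealD(1)[OF homM] by (simp_all add: S)
  have I_eq: "I = M \<cdot>\<^bsub>S\<^esub> P" unfolding I_def M_def m by (rule ideals_set_pow_Suc)
  have I_sub: "I \<subseteq> M" "I \<subseteq> P"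
    unfolding I_eq using S.ideal_prod_inter[OF idM P.ideal_axioms] by auto
  have R_eq: "R = S Quot I" by (simp add: R I_def)
  interpret R: cring R unfolding R_eq by (rule ideal.quotient_is_cring[OF idI S.is_cring])

  have dimR: "krull_dim R = enat r" using xs by (simp add: hsop_def r_def)
  have primeq: "primeideal \<qq> R" and dimq: "krull_dim (R Quot \<qq>) = krull_dim R"
    using q by (simp_all add: Assh_def Ass_def)
  interpret q: primeideal \<qq> R by (rule primeq)
  define p where "p = (+>\<^bsub>S\<^esub>) I ` P"
  have primep: "primeideal p R"
    unfolding p_def R_eq by (rule S.primeideal_quot_image[OF idI P(1) I_sub(2)])
  \<comment> \<open>The \<open>n\<close>-th power of an element of \<open>P\<close> lies in
    \<open>I\<close>, hence in \<open>Q\<close>. With cofactor 1, primality gives either the element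
    itself or 1 in \<open>Q\<close>.\<close>
  have P_sub: "P \<subseteq> Q" if Q: "primeideal Q S" "I \<subseteq> Q" for Q
  proof
    fix f assume f: "f \<in> P"
    then have fc: "f \<in> carrier (mpoly_ring d)" using P.a_subset S by auto
    have "f ^ n \<in> I" unfolding I_def S by (rule power_mem_ideals_set_pow[OF f fc])
    then have "f \<in> Q \<or> 1 \<in> Q"
      using primeideal_mpoly_power[of Q d f 1 n] Q fc by (auto simp: S)
    then show "f \<in> Q" using primeideal_mpoly(2)[of Q d] Q(1) by (simp add: S)
  qed
  have q_eq: "\<qq> = p"
  proof (rule ccontr)
    assume neq: "\<qq> \<noteq> p"
    have "P \<subseteq> quot_vimage S I \<qq>"
      using S.primeideal_quot_vimage[OF idI] S.quot_vimage_superset[OF idI] primeq q.ideal_axioms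
      unfolding R_eq by (intro P_sub) auto
    then have "p \<subset> \<qq>" using neq by (auto simp: p_def quot_vimage_def)
    \<comment> \<open>The zero ideal of the domain \<open>R Quot \<qq>\<close> is the prime that
      keeps the spectrum of the quotient nonempty; \<open>p\<close> is the element prolonging the
      chains.\<close>
    then have "eSuc (krull_dim (R Quot \<qq>)) \<le> krull_dim R"
      using domain.zeroprimeideal[OF q.quotient_is_domain]
      by (intro R.eSuc_krull_dim_Quot_le[OF q.ideal_axioms _ primep]) auto
    then show False unfolding dimq dimR by (simp add: eSuc_enat)
  qed
  obtain g where g: "g \<in> P" "u = I +>\<^bsub>S\<^esub> g" using u q_eq by (auto simp: p_def)
  have gc: "g \<in> carrier S" using g(1) P.a_subset by auto

  \<comment> \<open>The grading of \<open>R\<close> is the image of that of \<open>S\<close>, so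
    each parameter lifts to a form of positive degree.\<close>
  have "\<exists>F e. x = I +>\<^bsub>S\<^esub> F \<and> F \<in> mpoly_grading d e \<and> e > 0" if "x \<in> set xs" for x
  proof -
    obtain e where "e > 0" "x \<in> G e" using xs \<open>x \<in> set xs\<close> unfolding hsop_def by blast
    then show ?thesis by (auto simp: G quot_grading_def I_def)
  qed
  then obtain F' e' where F': "\<And>x. x \<in> set xs \<Longrightarrow>
      x = I +>\<^bsub>S\<^esub> F' x \<and> F' x \<in> mpoly_grading d (e' x) \<and> e' x > 0"
    by metis
  define F e where "F i = F' (xs ! i)" and "e i = e' (xs ! i)" for i
  have F: "xs ! i = I +>\<^bsub>S\<^esub> F i" "F i \<in> mpoly_grading d (e i)" "e i > 0" if "i < r" for i
    using F'[of "xs ! i"] that by (auto simp: F_def e_def r_def)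
  define B where "B = lin_span d r F"
  \<comment> \<open>Adding \<open>I\<close> to the ideal of the lifts makes room for the whole
    preimage of \<open>K\<close>; \<open>KJ\<close> below is this inclusion.\<close>
  define J where "J = B <+>\<^bsub>S\<^esub> I"
  have homB: "homog_ideal d B" unfolding B_def by (rule homog_ideal_lin_span) (rule F(2))
  have homJ: "homog_ideal d J" unfolding J_def S by (rule homog_ideal_set_add[OF homB homI])
  have idB: "ideal B S" and idJ: "ideal J S"
    using homog_idealD(1)[OF homB] homog_idealD(1)[OF homJ] by (simp_all add: S)
  have B_sub_J: "B \<subseteq> J" and I_sub_J: "I \<subseteq> J"
    using ideal_mpoly_0[of B d] ideal_mpoly_0[of I d] idB idI
    by (force simp: J_def S set_add_def')+
  have J_least: "J \<subseteq> A" if "ideal A S" "B \<subseteq> A" "I \<subseteq> A" for A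
    using that ideal_mpoly_add[of A d] by (auto simp: J_def S set_add_def')

  have idK: "ideal K R" and KJ: "quot_vimage S I K \<subseteq> J"
  proof -
    have xsJ: "set xs \<subseteq> (+>\<^bsub>S\<^esub>) I ` J"
    proof
      fix x assume "x \<in> set xs"
      then obtain i where i: "i < r" "x = xs ! i" by (auto simp: in_set_conv_nth r_def)
      then have "F i \<in> J" using lin_span_mem[of i r F d] B_sub_J by (auto simp: B_def)
      then show "x \<in> (+>\<^bsub>S\<^esub>) I ` J" using F(1)[OF i(1)] i(2) by blast
    qed
    have im: "ideal ((+>\<^bsub>S\<^esub>) I ` J) R"
      unfolding R_eq by (rule S.ring_ideal_imp_quot_ideal[OF idI idJ])
    have "set xs \<subseteq> carrier R"
      using xsJ additive_subgroup.a_subset[OF ideal.axioms(1)[OF im]] by blast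
    then show "ideal K R" unfolding K_def by (rule R.genideal_ideal)
    have "K \<subseteq> (+>\<^bsub>S\<^esub>) I ` J" unfolding K_def by (rule R.genideal_minimal[OF im xsJ])
    then show "quot_vimage S I K \<subseteq> J"
      using S.quot_image_memD[OF idI idJ I_sub_J] by (auto simp: quot_vimage_def)
  qed
  \<comment> \<open>The assumption on the annihilator, carried over to \<open>S\<close>. It is
    applied to \<open>M\<close>, and to the element 1 when \<open>P\<close> is zero.\<close>
  have annJ: "f \<in> J" if f: "f \<in> carrier S" "f * g \<in> I" for f
  proof -
    have "(I +>\<^bsub>S\<^esub> f) \<otimes>\<^bsub>R\<^esub> u = I +>\<^bsub>S\<^esub> (f * g)"
      unfolding R_eq g(2) S.mult_Quot[OF idI f(1) gc] by (simp add: S)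
    also have "\<dots> = \<zero>\<^bsub>R\<^esub>" by (simp add: S.a_rcos_zero[OF idI f(2)] R_eq zero_Quot)
    finally have "I +>\<^bsub>S\<^esub> f \<in> annihilator R u"
      using f(1) by (auto simp: annihilator_def R_eq carrier_Quot)
    then show ?thesis using ann f(1) KJ by (auto simp: quot_vimage_def K_def)
  qed
  have "M \<subseteq> J"
  proof
    fix f assume f: "f \<in> M"
    then have "f * g \<in> I" using ideal_prod.prod[OF f g(1), of S] by (simp add: I_eq S)
    then show "f \<in> J" using annJ ideal.Icarr[OF idM f] by blast
  qed
  then have "M \<subseteq> B"
    by (intro graded_Nakayama[OF homM homB homP P_irr]) (simp add: J_def I_eq S)
  then have JB: "J \<subseteq> B" using I_sub(1) by (intro J_least idB) auto

  show False
  proof (cases "P = {0}")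
    case True
    then have "1 * g \<in> I" using g(1) ideal_mpoly_0[of I d] idI by (simp add: S)
    then have "1 \<in> J" by (intro annJ) (simp add: S)
    moreover have "B \<subseteq> irrelevant_ideal d"
      unfolding B_def
      using F(2,3) mpoly_grading_subset_irrelevant_ideal
      by (intro lin_span_subset_ideal[OF ideal_irrelevant_ideal]) blast
    ultimately show False using one_notin_irrelevant_ideal JB by blast
  next
    case False
    then obtain f where f: "f \<in> P" "f \<noteq> 0" using ideal_mpoly_0[of P d] P.ideal_axioms by (auto simp: S)
    have "{0} \<subset> Q" if Q: "primeideal Q S" "I \<subseteq> Q" for Q
      using P_sub[OF Q] f ideal_mpoly_0[of Q d] primeideal.axioms(1)[OF Q(1)] by (auto simp: S)
    then have "eSuc (krull_dim R) \<le> krull_dim S"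
      using primeq primeideal_mpoly_zero[of d] unfolding R_eq
      by (intro S.eSuc_krull_dim_Quot_le[OF idI]) (auto simp: S)
    also have "\<dots> \<le> enat d" unfolding S by (rule krull_dim_mpoly_ring_le)
    finally have "Suc r \<le> d" by (simp add: dimR eSuc_enat)
    moreover have "\<exists>j. mpoly_grading d j \<subseteq> J"
    proof (rule finite_length_contains_degree[OF _ homJ])
      show "ideal I (mpoly_ring d)" using idI by (simp add: S)
      show "ideal K (mpoly_ring d Quot I)" using idK by (simp add: R_eq S)
      show "quot_vimage (mpoly_ring d) I K \<subseteq> J" using KJ by (simp add: S)
      show "module_length (mpoly_ring d Quot I) (quot_module (mpoly_ring d Quot I) K) < \<infinity>"
        using xs by (simp add: hsop_def K_def R_eq S)
    qed
    \<comment> \<open>A single degree contained in the ideal is enough, since all higher degrees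
      follow by multiplication with variables.\<close>
    then obtain j where "mpoly_grading d j \<subseteq> lin_span d r F" using JB by (auto simp: B_def)
    then have "mpoly_grading d l \<subseteq> lin_span d r F" if "l \<ge> j" for l
      using that homog_idealD(1)[OF homB] mpoly_grading_subset_ideal_ge unfolding B_def by blast
    then have "d \<le> r"
      using F(2,3) by (intro num_homogeneous_generators_ge[of r F d e j]) auto
    ultimately show False by simp
  qed
qed

end
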